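(* The type-structure $\mathcal C^{\le}=(\mathcal C^\le_\sigma)_\sigma$, where $\mathcal C^\le_\sigma:=\{x\in\mathcal S_\sigma:\ \mathcal S^\omega_*\models\exists\boldsymbol a\,\forall\boldsymbol b\,\langle\mathcal I_\sigma(x)\rangle^{\boldsymbol a}_{\boldsymbol b}\}$ with $\langle\cdot\rangle$ the canonical-upon-bounding interpretation, is a model of Gödel's theory $\mathsf T$.
   Context: Types: finite types are generated by $\sigma\to\tau$ from the ground types $\mathbb N$, $\mathbb B$ (Booleans); star types allow in addition $\sigma\mapsto\sigma^*$. $\mathcal S^\omega_*$ is the full set-theoretic structure: $\mathcal S_{\mathbb N}=\mathbb N$, $\mathcal S_{\mathbb B}=\{0,1\}$, $\mathcal S_{\rho\to\sigma}$ is the set of all functions from $\mathcal S_\rho$ to $\mathcal S_\sigma$, $\mathcal S_{\sigma^*}$ the set of all non-empty finite subsets of $\mathcal S_\sigma$. Boldface letters are (possibly empty) tuples; $\forall\boldsymbol b\in\boldsymbol B$ means $\forall b_1\in B_1\cdots\forall b_n\in B_n$. For each finite type $\sigma$, tuples of star types $\boldsymbol\tau_\sigma^+,\boldsymbol\tau_\sigma^-$ and the relation $\langle\mathcal I_\sigma(x)\rangle^{\boldsymbol a}_{\boldsymbol b}$ ($x:\sigma$, $\boldsymbol a:\boldsymbol\tau_\sigma^+$, $\boldsymbol b:\boldsymbol\tau_\sigma^-$) are defined by recursion: $\langle\mathcal I_{\mathbb N}(x)\rangle^n$ is $x\le n$ ($\tau^+_{\mathbb N}=\mathbb N$, $\boldsymbol\tau^-_{\mathbb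 N}$ empty); $\langle\mathcal I_{\mathbb B}(i)\rangle$ is true (both tuples empty); and $$\langle\mathcal I_{\rho\to\sigma}(h)\rangle^{\boldsymbol f,\boldsymbol g}_{\boldsymbol a,\boldsymbol d}:\equiv\forall x^\rho(\forall\boldsymbol b\in\boldsymbol g\boldsymbol a\boldsymbol d\,\langle\mathcal I_\rho(x)\rangle^{\boldsymbol a}_{\boldsymbol b}\to\langle\mathcal I_\sigma(hx)\rangle^{\boldsymbol f\boldsymbol a}_{\boldsymbol d}),$$ where $\boldsymbol a:\boldsymbol\tau^+_\rho$, $\boldsymbol d:\boldsymbol\tau^-_\sigma$, $\boldsymbol f$ maps $\boldsymbol\tau_\rho^+$ to $\boldsymbol\tau_\sigma^+$, and $\boldsymbol g$ maps $\boldsymbol\tau_\rho^+,\boldsymbol\tau_\sigma^-$ to tuples of non-empty finite sets of elements of the types $\boldsymbol\tau_\rho^-$. Gödel's $\mathsf T$ is the quantifier-free theory of primitive recursive functionals over the arithmetical types (generated from $\mathbb N$ by $\to$), with constants the combinators $\Pi,\Sigma$, $0$, successor $\mathsf S$ and recursors $\mathsf R_\sigma$ ($\mathsf R0wf=w$, $\mathsf R(\mathsf Sn)wf=fn(\mathsf Rnwf)$). That a family $\mathcal C_\sigma\subseteq\mathcal S_\sigma$ is a model of $\mathsf T$ means: $\mathcal C_{\mathbb N}=\mathbb N$, the family is closed under application and contains the set-theoretic combinators, zero, successor and recursors of arithmetical type, which interpret the constants of $\mathsf T$ (so that the axioms of $\mathsf T$ hold). *)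

theory Defs
  imports "HOL-Library.FuncSet"
begin

datatype ftype = FNat | FBool | FFun ftype ftype (infixr "\<rightarrow>\<^sub>f" 65)

datatype stype = SNat | SBool | SFun stype stype (infixr "\<rightarrow>\<^sub>s" 65) | Star stype

primrec star_of :: "ftype \<Rightarrow> stype" where
  "star_of FNat = SNat"
| "star_of FBool = SBool"
| "star_of (\<rho> \<rightarrow>\<^sub>f \<sigma>) = star_of \<rho> \<rightarrow>\<^sub>s star_of \<sigma>"

primrec arithmetical :: "ftype \<Rightarrow> bool" where
  "arithmetical FNat \<longleftrightarrow> True"
| "arithmetical FBool \<longleftrightarrow> False"
| "arithmetical (\<rho> \<rightarrow>\<^sub>f \<sigma>) \<longleftrightarrow> arithmetical \<rho> \<and> arithmetical \<sigma>"


text \<open>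
  The full set-theoretic structure over the star types, up to isomorphism: a single type \<open>'u\<close>
  carries all the sets \<open>S\<^sub>\<tau>\<close>, an element \<open>h\<close> of functional type denotes the function \<open>app M h\<close>
  on its domain, and an element \<open>s\<close> of type \<open>Star \<sigma>\<close> denotes the set \<open>elems M s\<close>.
\<close>

record 'u type_structure =
  carr :: "stype \<Rightarrow> 'u set"
  nat_el :: "nat \<Rightarrow> 'u"
  bool_el :: "bool \<Rightarrow> 'u"
  app :: "'u \<Rightarrow> 'u \<Rightarrow> 'u"
  elems :: "'u \<Rightarrow> 'u set"

definition component_closed :: "stype set \<Rightarrow> bool" where
  "component_closed D \<longleftrightarrow>
     SNat \<in> D \<and> SBool \<in> D \<and>
     (\<forall>\<rho> \<sigma>. \<rho> \<rightarrow>\<^sub>s \<sigma> \<in> D \<longrightarrow> \<rho> \<in> D \<and> \<sigma> \<in> D) \<and>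
     (\<forall>\<sigma>. Star \<sigma> \<in> D \<longrightarrow> \<sigma> \<in> D)"

text \<open>
  \<open>full_structure D M\<close>: \<open>M\<close> is the full set-theoretic structure at the star types in \<open>D\<close>.
  The structure of all star types is the case \<open>D = UNIV\<close>. The union of all the sets \<open>S\<^sub>\<tau>\<close> is
  larger than every type that can be constructed in HOL, so for \<open>D = UNIV\<close> the type \<open>'u\<close> has
  to be assumed large enough. With \<open>D\<close> as a parameter, every finite level is covered too, and there
  \<open>full_structure_base\<close> and \<open>full_structure_step\<close> below construct the structure; by
  \<open>next_level_exhausts\<close> every star type belongs to some level.
\<close>

definition full_structure :: "stype set \<Rightarrow> 'u type_structure \<Rightarrow> bool" where
  "full_structure D M \<longleftrightarrow>
     component_closed D \<and>
     bij_betw (nat_el M) UNIV (carr M SNat) \<and>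
     bij_betw (bool_el M) UNIV (carr M SBool) \<and>
     (\<forall>\<rho> \<sigma>. \<rho> \<rightarrow>\<^sub>s \<sigma> \<in> D \<longrightarrow>
        bij_betw (\<lambda>h. restrict (app M h) (carr M \<rho>))
          (carr M (\<rho> \<rightarrow>\<^sub>s \<sigma>)) (carr M \<rho> \<rightarrow>\<^sub>E carr M \<sigma>)) \<and>
     (\<forall>\<sigma>. Star \<sigma> \<in> D \<longrightarrow>
        bij_betw (elems M) (carr M (Star \<sigma>)) {A. A \<subseteq> carr M \<sigma> \<and> finite A \<and> A \<noteq> {}})"

lemma full_structure_base:
  "\<exists>M :: (nat + bool) type_structure. full_structure {SNat, SBool} M"
proof -
  define M :: "(nat + bool) type_structure" where
    "M = \<lparr>carr = (\<lambda>t. if t = SNat then range Inl else range Inr),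
          nat_el = Inl, bool_el = Inr, app = (\<lambda>h x. x), elems = (\<lambda>s. {})\<rparr>"
  have "full_structure {SNat, SBool} M"
    by (auto simp: full_structure_def component_closed_def M_def bij_betw_def inj_on_def)
  then show ?thesis by blast
qed

datatype 'u extension = Old 'u | Fn "'u \<Rightarrow> 'u" | Fs "'u set"

definition next_level :: "stype set \<Rightarrow> stype set" where
  "next_level D = D \<union> {\<rho> \<rightarrow>\<^sub>s \<sigma> | \<rho> \<sigma>. \<rho> \<in> D \<and> \<sigma> \<in> D} \<union> Star ` D"

lemma next_level_exhausts: "\<exists>n. t \<in> (next_level ^^ n) {SNat, SBool}"
proof -
  have le: "(next_level ^^ m) X \<subseteq> (next_level ^^ (m + k)) X" for m k X
    by (induction k) (auto simp: next_level_def)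
  show ?thesis
  proof (induction t)
    case SNat
    show ?case by (rule exI[of _ 0]) simp
  next
    case SBool
    show ?case by (rule exI[of _ 0]) simp
  next
    case (SFun \<rho> \<sigma>)
    then obtain m n where "\<rho> \<in> (next_level ^^ m) {SNat, SBool}"
      "\<sigma> \<in> (next_level ^^ n) {SNat, SBool}" by blast
    then have "\<rho> \<in> (next_level ^^ (m + n)) {SNat, SBool}"
      "\<sigma> \<in> (next_level ^^ (m + n)) {SNat, SBool}"
      using le[of m _ n] le[of n _ m] by (auto simp: add.commute)
    then have "\<rho> \<rightarrow>\<^sub>s \<sigma> \<in> (next_level ^^ Suc (m + n)) {SNat, SBool}"
      by (simp add: next_level_def)
    then show ?case by blast
  next
    case (Star \<sigma>)
    then obtain n where "\<sigma> \<in> (next_level ^^ n) {SNat, SBool}" by blast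
    then have "Star \<sigma> \<in> (next_level ^^ Suc n) {SNat, SBool}"
      by (simp add: next_level_def)
    then show ?case by blast
  qed
qed

lemma full_structure_step:
  fixes M :: "'u type_structure"
  assumes M: "full_structure D M"
  shows "\<exists>M' :: 'u extension type_structure. full_structure (next_level D) M'"
proof -
  define c where "c t = (if t \<in> D then Old ` carr M t else
     (case t of \<rho> \<rightarrow>\<^sub>s \<sigma> \<Rightarrow> Fn ` (carr M \<rho> \<rightarrow>\<^sub>E carr M \<sigma>)
        | Star \<sigma> \<Rightarrow> Fs ` {A. A \<subseteq> carr M \<sigma> \<and> finite A \<and> A \<noteq> {}} | _ \<Rightarrow> {}))" for t
  define ap where "ap h x = (case x of Old y \<Rightarrow>
     (case h of Old g \<Rightarrow> Old (app M g y) | Fn f \<Rightarrow> Old (f y) | Fs A \<Rightarrow> x) | _ \<Rightarrow> x)"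
    for h x :: "'u extension"
  define el where "el s = (case s of Old y \<Rightarrow> Old ` elems M y | Fs A \<Rightarrow> Old ` A | _ \<Rightarrow> {})"
    for s :: "'u extension"
  define M' where "M' = \<lparr>carr = c, nat_el = Old \<circ> nat_el M, bool_el = Old \<circ> bool_el M,
     app = ap, elems = el\<rparr>"
  have D: "component_closed D"
    and bn: "bij_betw (nat_el M) UNIV (carr M SNat)"
    and bb: "bij_betw (bool_el M) UNIV (carr M SBool)"
    and bf: "\<And>\<rho> \<sigma>. \<rho> \<rightarrow>\<^sub>s \<sigma> \<in> D \<Longrightarrow> bij_betw (\<lambda>h. restrict (app M h) (carr M \<rho>))
          (carr M (\<rho> \<rightarrow>\<^sub>s \<sigma>)) (carr M \<rho> \<rightarrow>\<^sub>E carr M \<sigma>)"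
    and bs: "\<And>\<sigma>. Star \<sigma> \<in> D \<Longrightarrow>
        bij_betw (elems M) (carr M (Star \<sigma>)) {A. A \<subseteq> carr M \<sigma> \<and> finite A \<and> A \<noteq> {}}"
    using M unfolding full_structure_def by blast+
  have DN: "SNat \<in> D" and DB: "SBool \<in> D"
    and DF: "\<And>\<rho> \<sigma>. \<rho> \<rightarrow>\<^sub>s \<sigma> \<in> D \<Longrightarrow> \<rho> \<in> D \<and> \<sigma> \<in> D"
    and DS: "\<And>\<sigma>. Star \<sigma> \<in> D \<Longrightarrow> \<sigma> \<in> D"
    using D unfolding component_closed_def by blast+
  have nF: "\<rho> \<in> D \<and> \<sigma> \<in> D" if "\<rho> \<rightarrow>\<^sub>s \<sigma> \<in> next_level D" for \<rho> \<sigma>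
    using that DF unfolding next_level_def by blast
  have nS: "\<sigma> \<in> D" if "Star \<sigma> \<in> next_level D" for \<sigma>
    using that DS unfolding next_level_def by blast
  have cl: "component_closed (next_level D)"
    unfolding component_closed_def using DN DB nF nS
    by (metis (no_types, lifting) UnI1 next_level_def)
  have old: "bij_betw Old A (Old ` A)" for A :: "'u set"
    by (simp add: bij_betw_def inj_on_def)
  have lift: "bij_betw (\<lambda>f. \<lambda>x\<in>Old ` X. Old (f (case x of Old y \<Rightarrow> y)))
      (X \<rightarrow>\<^sub>E Y) (Old ` X \<rightarrow>\<^sub>E Old ` Y)" (is "bij_betw ?L _ _") for X Y :: "'u set"
  proof -
    have "inj_on ?L (X \<rightarrow>\<^sub>E Y)"
    proof (rule inj_onI)
      fix f g assume f: "f \<in> X \<rightarrow>\<^sub>E Y" and g: "g \<in> X \<rightarrow>\<^sub>E Y" and eq: "?L f = ?L g"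
      show "f = g"
      proof (rule PiE_ext[OF f g])
        fix y assume "y \<in> X"
        with fun_cong[OF eq, of "Old y"] show "f y = g y" by simp
      qed
    qed
    moreover have "?L f \<in> Old ` X \<rightarrow>\<^sub>E Old ` Y" if "f \<in> X \<rightarrow>\<^sub>E Y" for f
      using PiE_mem[OF that] by (intro PiE_I) auto
    moreover have "F \<in> ?L ` (X \<rightarrow>\<^sub>E Y)" if F: "F \<in> Old ` X \<rightarrow>\<^sub>E Old ` Y" for F
    proof -
      define f where "f = (\<lambda>y\<in>X. case F (Old y) of Old z \<Rightarrow> z)"
      have ex: "\<exists>z\<in>Y. F (Old y) = Old z" if "y \<in> X" for y
        using PiE_mem[OF F, of "Old y"] that by auto
      have f: "f \<in> X \<rightarrow>\<^sub>E Y"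
        unfolding f_def using ex by (intro PiE_I) force+
      have "F x = ?L f x" for x
      proof (cases "x \<in> Old ` X")
        case True
        then obtain y where y: "y \<in> X" "x = Old y" by blast
        then obtain z where "z \<in> Y" "F (Old y) = Old z" using ex by blast
        with y show ?thesis by (simp add: f_def)
      next
        case False
        then show ?thesis using PiE_arb[OF F False] by simp
      qed
      then have "F = ?L f" by blast
      then show ?thesis using f by blast
    qed
    ultimately show ?thesis unfolding bij_betw_def by blast
  qed
  have liftA: "bij_betw (\<lambda>A. Old ` A) {A. A \<subseteq> X \<and> finite A \<and> A \<noteq> {}}
      {A. A \<subseteq> Old ` X \<and> finite A \<and> A \<noteq> {}}" for X :: "'u set"
  proof -
    have "B \<in> (\<lambda>A. Old ` A) ` {A. A \<subseteq> X \<and> finite A \<and> A \<noteq> {}}"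
      if B: "B \<subseteq> Old ` X" "finite B" "B \<noteq> {}" for B
    proof -
      obtain A where A: "A \<subseteq> X" "finite A" "B = Old ` A"
        using finite_subset_image[OF B(2,1)] by blast
      then show ?thesis using B(3) by blast
    qed
    moreover have "inj_on (\<lambda>A. Old ` A) {A. A \<subseteq> X \<and> finite A \<and> A \<noteq> {}}"
      by (auto simp: inj_on_def)
    ultimately show ?thesis unfolding bij_betw_def by blast
  qed
  have 1: "bij_betw (nat_el M') UNIV (carr M' SNat)"
    using DN bij_betw_trans[OF bn old] by (simp add: M'_def c_def)
  have 2: "bij_betw (bool_el M') UNIV (carr M' SBool)"
    using DB bij_betw_trans[OF bb old] by (simp add: M'_def c_def)
  have 3: "bij_betw (\<lambda>h. restrict (app M' h) (carr M' \<rho>))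
          (carr M' (\<rho> \<rightarrow>\<^sub>s \<sigma>)) (carr M' \<rho> \<rightarrow>\<^sub>E carr M' \<sigma>)"
    if mem: "\<rho> \<rightarrow>\<^sub>s \<sigma> \<in> next_level D" for \<rho> \<sigma>
  proof -
    let ?L = "\<lambda>f. \<lambda>x\<in>Old ` carr M \<rho>. Old (f (case x of Old y \<Rightarrow> y))"
    have rs: "\<rho> \<in> D" "\<sigma> \<in> D"
      using nF[OF mem] by simp_all
    then have c: "carr M' \<rho> = Old ` carr M \<rho>" "carr M' \<sigma> = Old ` carr M \<sigma>"
      by (simp_all add: M'_def c_def)
    show ?thesis
    proof (cases "\<rho> \<rightarrow>\<^sub>s \<sigma> \<in> D")
      case True
      have "bij_betw (?L \<circ> (\<lambda>h. restrict (app M h) (carr M \<rho>))) (carr M (\<rho> \<rightarrow>\<^sub>s \<sigma>))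
          (Old ` carr M \<rho> \<rightarrow>\<^sub>E Old ` carr M \<sigma>)"
        by (rule bij_betw_trans[OF bf[OF True] lift])
      also have "?L \<circ> (\<lambda>h. restrict (app M h) (carr M \<rho>)) =
          (\<lambda>h. restrict (app M' h) (carr M' \<rho>)) \<circ> Old"
        unfolding c by (auto simp: fun_eq_iff M'_def ap_def)
      finally have "bij_betw ((\<lambda>h. restrict (app M' h) (carr M' \<rho>)) \<circ> Old) (carr M (\<rho> \<rightarrow>\<^sub>s \<sigma>))
          (Old ` carr M \<rho> \<rightarrow>\<^sub>E Old ` carr M \<sigma>)" .
      then have "bij_betw (\<lambda>h. restrict (app M' h) (carr M' \<rho>)) (Old ` carr M (\<rho> \<rightarrow>\<^sub>s \<sigma>))
          (Old ` carr M \<rho> \<rightarrow>\<^sub>E Old ` carr M \<sigma>)"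
        by (simp add: bij_betw_comp_iff[OF old])
      then show ?thesis using True c by (simp add: M'_def c_def)
    next
      case False
      have fn: "bij_betw Fn A (Fn ` A)" for A :: "('u \<Rightarrow> 'u) set"
        by (simp add: bij_betw_def inj_on_def)
      have "?L = (\<lambda>h. restrict (app M' h) (carr M' \<rho>)) \<circ> Fn"
        unfolding c by (auto simp: fun_eq_iff M'_def ap_def)
      with lift[of "carr M \<rho>" "carr M \<sigma>"]
      have "bij_betw ((\<lambda>h. restrict (app M' h) (carr M' \<rho>)) \<circ> Fn) (carr M \<rho> \<rightarrow>\<^sub>E carr M \<sigma>)
          (Old ` carr M \<rho> \<rightarrow>\<^sub>E Old ` carr M \<sigma>)" by simp
      then have "bij_betw (\<lambda>h. restrict (app M' h) (carr M' \<rho>)) (Fn ` (carr M \<rho> \<rightarrow>\<^sub>E carr M \<sigma>))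
          (Old ` carr M \<rho> \<rightarrow>\<^sub>E Old ` carr M \<sigma>)"
        by (simp add: bij_betw_comp_iff[OF fn])
      then show ?thesis using False c by (simp add: M'_def c_def)
    qed
  qed
  have 4: "bij_betw (elems M') (carr M' (Star \<sigma>)) {A. A \<subseteq> carr M' \<sigma> \<and> finite A \<and> A \<noteq> {}}"
    if mem: "Star \<sigma> \<in> next_level D" for \<sigma>
  proof -
    have "\<sigma> \<in> D"
      by (rule nS[OF mem])
    then have c: "carr M' \<sigma> = Old ` carr M \<sigma>"
      by (simp add: M'_def c_def)
    show ?thesis
    proof (cases "Star \<sigma> \<in> D")
      case True
      have "(\<lambda>A. Old ` A) \<circ> elems M = elems M' \<circ> Old"
        by (auto simp: fun_eq_iff M'_def el_def)
      with bij_betw_trans[OF bs[OF True] liftA]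
      have "bij_betw (elems M' \<circ> Old) (carr M (Star \<sigma>))
          {A. A \<subseteq> Old ` carr M \<sigma> \<and> finite A \<and> A \<noteq> {}}" by simp
      then have "bij_betw (elems M') (Old ` carr M (Star \<sigma>))
          {A. A \<subseteq> Old ` carr M \<sigma> \<and> finite A \<and> A \<noteq> {}}"
        by (simp add: bij_betw_comp_iff[OF old])
      then show ?thesis using True c by (simp add: M'_def c_def)
    next
      case False
      have fs: "bij_betw Fs A (Fs ` A)" for A :: "'u set set"
        by (simp add: bij_betw_def inj_on_def)
      have "(elems M' \<circ> Fs) A = Old ` A" for A
        by (simp add: M'_def el_def)
      then have "bij_betw (elems M' \<circ> Fs) {A. A \<subseteq> carr M \<sigma> \<and> finite A \<and> A \<noteq> {}}
          {A. A \<subseteq> Old ` carr M \<sigma> \<and> finite A \<and> A \<noteq> {}}"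
        using liftA[of "carr M \<sigma>"] by (rule bij_betw_cong[THEN iffD2])
      then have "bij_betw (elems M') (Fs ` {A. A \<subseteq> carr M \<sigma> \<and> finite A \<and> A \<noteq> {}})
          {A. A \<subseteq> Old ` carr M \<sigma> \<and> finite A \<and> A \<noteq> {}}"
        by (simp add: bij_betw_comp_iff[OF fs])
      then show ?thesis using False c by (simp add: M'_def c_def)
    qed
  qed
  show ?thesis
    using cl 1 2 3 4 unfolding full_structure_def by blast
qed


text \<open>
  Tuples are lists. A tuple of functions on a tuple is curried:
  \<open>funs [\<tau>\<^sub>1, \<dots>, \<tau>\<^sub>n] \<tau>\<close> is \<open>\<tau>\<^sub>1 \<rightarrow> \<dots> \<rightarrow> \<tau>\<^sub>n \<rightarrow> \<tau>\<close>.
\<close>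

definition funs :: "stype list \<Rightarrow> stype \<Rightarrow> stype" where
  "funs ts t = foldr SFun ts t"

definition apps :: "'u type_structure \<Rightarrow> 'u \<Rightarrow> 'u list \<Rightarrow> 'u" where
  "apps M h xs = foldl (app M) h xs"

fun tau_pos :: "ftype \<Rightarrow> stype list" and tau_neg :: "ftype \<Rightarrow> stype list" where
  "tau_pos FNat = [SNat]"
| "tau_pos FBool = []"
| "tau_pos (\<rho> \<rightarrow>\<^sub>f \<sigma>) =
     map (\<lambda>t. funs (tau_pos \<rho>) t) (tau_pos \<sigma>) @
     map (\<lambda>t. funs (tau_pos \<rho> @ tau_neg \<sigma>) (Star t)) (tau_neg \<rho>)"
| "tau_neg FNat = []"
| "tau_neg FBool = []"
| "tau_neg (\<rho> \<rightarrow>\<^sub>f \<sigma>) = tau_pos \<rho> @ tau_neg \<sigma>"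

definition tuples :: "'u type_structure \<Rightarrow> stype list \<Rightarrow> 'u list set" where
  "tuples M ts = listset (map (carr M) ts)"

text \<open>
  \<open>interp M \<sigma> x p n\<close> is \<open>\<langle>I\<^sub>\<sigma>(x)\<rangle>\<close> with upper tuple \<open>p\<close> and lower tuple \<open>n\<close>, evaluated in \<open>M\<close>.
  At a functional type \<open>p\<close> is the concatenation of \<open>f\<close> and \<open>g\<close>, and \<open>n\<close> that of \<open>a\<close> and \<open>d\<close>.
\<close>

primrec interp :: "'u type_structure \<Rightarrow> ftype \<Rightarrow> 'u \<Rightarrow> 'u list \<Rightarrow> 'u list \<Rightarrow> bool" where
  "interp M FNat x p n \<longleftrightarrow> (\<exists>i k. x = nat_el M i \<and> p = [nat_el M k] \<and> i \<le> k)"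
| "interp M FBool x p n \<longleftrightarrow> True"
| "interp M (\<rho> \<rightarrow>\<^sub>f \<sigma>) h p n \<longleftrightarrow>
     (let f = take (length (tau_pos \<sigma>)) p;
          g = drop (length (tau_pos \<sigma>)) p;
          a = take (length (tau_pos \<rho>)) n;
          d = drop (length (tau_pos \<rho>)) n
      in \<forall>x \<in> carr M (star_of \<rho>).
           (\<forall>b \<in> listset (map (\<lambda>g\<^sub>j. elems M (apps M g\<^sub>j (a @ d))) g). interp M \<rho> x a b) \<longrightarrow>
           interp M \<sigma> (app M h x) (map (\<lambda>f\<^sub>i. apps M f\<^sub>i a) f) d)"

definition C_le :: "'u type_structure \<Rightarrow> ftype \<Rightarrow> 'u set" where
  "C_le M \<sigma> = {x \<in> carr M (star_of \<sigma>).
     \<exists>a \<in> tuples M (tau_pos \<sigma>). \<forall>b \<in> tuples M (tau_neg \<sigma>). interp M \<sigma> x a b}"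


text \<open>
  \<open>types_within D\<close>: the finite types \<open>\<sigma>\<close> for which all the types occurring in the definition of
  \<open>C_le M \<sigma>\<close> lie in \<open>D\<close>.
\<close>

definition types_within :: "stype set \<Rightarrow> ftype set" where
  "types_within D = {\<sigma>. star_of \<sigma> \<in> D \<and> set (tau_pos \<sigma>) \<subseteq> D \<and> set (tau_neg \<sigma>) \<subseteq> D}"

lemma types_within_UNIV [simp]: "types_within UNIV = UNIV"
  by (simp add: types_within_def)

text \<open>
  \<open>model_of_T F M C\<close>: the family \<open>C\<close> of subsets of \<open>M\<close> is a model of the part of \<open>T\<close> in which
  the constants and the functional types applied have types in \<open>F\<close>; it is a model of \<open>T\<close> if
  \<open>F = UNIV\<close>. The defining equations of the constants range over \<open>M\<close>, not just over \<open>C\<close>: they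
  single out the set-theoretic combinators, successor and recursors.
\<close>

definition model_of_T :: "ftype set \<Rightarrow> 'u type_structure \<Rightarrow> (ftype \<Rightarrow> 'u set) \<Rightarrow> bool" where
  "model_of_T F M C \<longleftrightarrow>
     (\<forall>\<sigma> \<in> F. C \<sigma> \<subseteq> carr M (star_of \<sigma>)) \<and>
     C FNat = carr M SNat \<and>
     (\<forall>\<rho> \<sigma>. \<rho> \<rightarrow>\<^sub>f \<sigma> \<in> F \<longrightarrow>
        (\<forall>h \<in> C (\<rho> \<rightarrow>\<^sub>f \<sigma>). \<forall>x \<in> C \<rho>. app M h x \<in> C \<sigma>)) \<and>
     (\<forall>\<rho> \<sigma>. arithmetical \<rho> \<and> arithmetical \<sigma> \<and> \<rho> \<rightarrow>\<^sub>f \<sigma> \<rightarrow>\<^sub>f \<rho> \<in> F \<longrightarrow>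
        (\<exists>k \<in> C (\<rho> \<rightarrow>\<^sub>f \<sigma> \<rightarrow>\<^sub>f \<rho>).
           \<forall>x \<in> carr M (star_of \<rho>). \<forall>y \<in> carr M (star_of \<sigma>).
             app M (app M k x) y = x)) \<and>
     (\<forall>\<rho> \<sigma> \<tau>. arithmetical \<rho> \<and> arithmetical \<sigma> \<and> arithmetical \<tau> \<and>
          (\<rho> \<rightarrow>\<^sub>f \<sigma> \<rightarrow>\<^sub>f \<tau>) \<rightarrow>\<^sub>f (\<rho> \<rightarrow>\<^sub>f \<sigma>) \<rightarrow>\<^sub>f \<rho> \<rightarrow>\<^sub>f \<tau> \<in> F \<longrightarrow>
        (\<exists>s \<in> C ((\<rho> \<rightarrow>\<^sub>f \<sigma> \<rightarrow>\<^sub>f \<tau>) \<rightarrow>\<^sub>f (\<rho> \<rightarrow>\<^sub>f \<sigma>) \<rightarrow>\<^sub>f \<rho> \<rightarrow>\<^sub>f \<tau>).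
           \<forall>x \<in> carr M (star_of (\<rho> \<rightarrow>\<^sub>f \<sigma> \<rightarrow>\<^sub>f \<tau>)). \<forall>y \<in> carr M (star_of (\<rho> \<rightarrow>\<^sub>f \<sigma>)).
           \<forall>z \<in> carr M (star_of \<rho>).
             app M (app M (app M s x) y) z = app M (app M x z) (app M y z))) \<and>
     nat_el M 0 \<in> C FNat \<and>
     (FNat \<rightarrow>\<^sub>f FNat \<in> F \<longrightarrow>
        (\<exists>s \<in> C (FNat \<rightarrow>\<^sub>f FNat). \<forall>n. app M s (nat_el M n) = nat_el M (Suc n))) \<and>
     (\<forall>\<sigma>. arithmetical \<sigma> \<and> FNat \<rightarrow>\<^sub>f \<sigma> \<rightarrow>\<^sub>f (FNat \<rightarrow>\<^sub>f \<sigma> \<rightarrow>\<^sub>f \<sigma>) \<rightarrow>\<^sub>f \<sigma> \<in> F \<longrightarrow>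
        (\<exists>r \<in> C (FNat \<rightarrow>\<^sub>f \<sigma> \<rightarrow>\<^sub>f (FNat \<rightarrow>\<^sub>f \<sigma> \<rightarrow>\<^sub>f \<sigma>) \<rightarrow>\<^sub>f \<sigma>).
           \<forall>w \<in> carr M (star_of \<sigma>). \<forall>f \<in> carr M (star_of (FNat \<rightarrow>\<^sub>f \<sigma> \<rightarrow>\<^sub>f \<sigma>)).
             apps M r [nat_el M 0, w, f] = w \<and>
             (\<forall>n. apps M r [nat_el M (Suc n), w, f] =
                  apps M f [nat_el M n, apps M r [nat_el M n, w, f]])))"

end

(*
  A lambda term whose free variables are bounded is bounded: a bound of the term is computed from
  bounds of the variables, and every challenge to it is answered by finitely many challenges to the
  variables. This is preserved by application and abstraction, so closed terms lie in C^le and the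
  combinators come for free. Bounds of positive type can be joined pointwise, so a definition by cases
  on a number n <= m is bounded if each case is: join the bounds and unite the challenges of the
  cases 0, ..., m. Each iterate R n w f with n fixed is a lambda term, hence the recursor is bounded.
*)

theory Submission
  imports Defs
begin

section \<open>Products of sets, tuples and curried application\<close>

lemma mem_listset_iff: "xs \<in> listset As \<longleftrightarrow> list_all2 (\<in>) xs As"
  by (induction As arbitrary: xs) (auto simp: set_Cons_def list_all2_Cons2)

lemma finite_listset: "(\<And>A. A \<in> set As \<Longrightarrow> finite A) \<Longrightarrow> finite (listset As)"
proof (induction As)
  case (Cons A As)
  then have "finite ((\<lambda>(x, xs). x # xs) ` (A \<times> listset As))" by simp
  also have "(\<lambda>(x, xs). x # xs) ` (A \<times> listset As) = listset (A # As)"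
    by (auto simp: set_Cons_def)
  finally show ?case .
qed simp

lemma mem_tuples_iff: "xs \<in> tuples M ts \<longleftrightarrow> list_all2 (\<lambda>x t. x \<in> carr M t) xs ts"
  by (simp add: tuples_def mem_listset_iff list_all2_map2)

lemma length_tuples: "xs \<in> tuples M ts \<Longrightarrow> length xs = length ts"
  by (simp add: mem_tuples_iff list_all2_lengthD)

lemma append_tuples: "xs \<in> tuples M ss \<Longrightarrow> ys \<in> tuples M ts \<Longrightarrow> xs @ ys \<in> tuples M (ss @ ts)"
  by (simp add: mem_tuples_iff list_all2_appendI)

lemma take_drop_tuples:
  assumes "xs \<in> tuples M (ss @ ts)"
  shows "take (length ss) xs \<in> tuples M ss" "drop (length ss) xs \<in> tuples M ts"
  using assms unfolding mem_tuples_iff list_all2_append2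
  by (auto dest: list_all2_lengthD)

lemma tuples_Nil [simp]: "tuples M [] = {[]}"
  by (simp add: tuples_def)

lemma apps_Cons [simp]: "apps M h (x # xs) = apps M (app M h x) xs"
  and apps_Nil [simp]: "apps M h [] = h"
  by (simp_all add: apps_def)

lemma funs_Cons [simp]: "funs (s # ts) t = s \<rightarrow>\<^sub>s funs ts t"
  and funs_Nil [simp]: "funs [] t = t"
  by (simp_all add: funs_def)

section \<open>The two halves of a bound of functional type\<close>

text \<open>The tuple written \<open>f a\<close> in the interpretation, for a bound \<open>p\<close>
  that concatenates \<open>f\<close> and \<open>g\<close>. The type locates the end of
  \<open>f\<close>.\<close>

definition upper :: "'u type_structure \<Rightarrow> ftype \<Rightarrow> 'u list \<Rightarrow> 'u list \<Rightarrow> 'u list" where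
  "upper M \<sigma> p a = map (\<lambda>f. apps M f a) (take (length (tau_pos \<sigma>)) p)"

text \<open>The product of the sets \<open>g a d\<close>: what the argument must withstand for the
  value to withstand \<open>d\<close>.\<close>

definition challenges :: "'u type_structure \<Rightarrow> ftype \<Rightarrow> 'u list \<Rightarrow> 'u list \<Rightarrow> 'u list \<Rightarrow> 'u list set" where
  "challenges M \<sigma> p a d =
     listset (map (\<lambda>g. elems M (apps M g (a @ d))) (drop (length (tau_pos \<sigma>)) p))"

text \<open>The length of \<open>a\<close> resolves the splitting of the lower tuple, so later
  proofs can reason with \<open>upper\<close> and \<open>challenges\<close> in place of the raw
  clause of \<open>interp\<close>.\<close>

lemma interp_FFun_iff:
  assumes "a \<in> tuples M (tau_pos \<rho>)"
  shows "interp M (\<rho> \<rightarrow>\<^sub>f \<sigma>) h p (a @ d) \<longleftrightarrow>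
    (\<forall>x \<in> carr M (star_of \<rho>). (\<forall>b \<in> challenges M \<sigma> p a d. interp M \<rho> x a b) \<longrightarrow>
      interp M \<sigma> (app M h x) (upper M \<sigma> p a) d)"
  using length_tuples[OF assms] by (simp add: Let_def upper_def challenges_def)

section \<open>Bounded terms in a context\<close>

text \<open>
  A premise is a family of conditions \<open>holds e a c\<close> on an environment \<open>e\<close> with upper bound \<open>a\<close>,
  indexed by challenges \<open>c\<close>. It generalises a list of typed variables, so that no indices are needed.
\<close>

record ('e, 'a, 'c) premise =
  envs :: "'e set"
  uppers :: "'a set"
  lowers :: "'c set"
  holds :: "'e \<Rightarrow> 'a \<Rightarrow> 'c \<Rightarrow> bool"

text \<open>The context of closed terms. HOL types are inhabited, so a single condition that always
  holds stands for the absence of conditions.\<close>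

definition empty_premise :: "(unit, unit, unit) premise" where
  "empty_premise = \<lparr>envs = UNIV, uppers = UNIV, lowers = UNIV, holds = (\<lambda>_ _ _. True)\<rparr>"

text \<open>The tags \<open>Inl\<close> and \<open>Inr\<close> tell whether a challenge is addressed
  to an earlier variable or to the new one.\<close>

definition add_var :: "'u type_structure \<Rightarrow> ('e, 'a, 'c) premise \<Rightarrow> ftype \<Rightarrow>
    ('e \<times> 'u, 'a \<times> 'u list, 'c + 'u list) premise" where
  "add_var M \<Gamma> \<rho> =
     \<lparr>envs = envs \<Gamma> \<times> carr M (star_of \<rho>),
      uppers = uppers \<Gamma> \<times> tuples M (tau_pos \<rho>),
      lowers = lowers \<Gamma> <+> tuples M (tau_neg \<rho>),
      holds = (\<lambda>(e, x) (a, p) c. case c of Inl c \<Rightarrow> holds \<Gamma> e a c | Inr b \<Rightarrow> interp M \<rho> x p b)\<rparr>"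

text \<open>\<open>P\<close> computes a bound of the term from bounds of the variables, and
  \<open>Q\<close> the finitely many challenges to the variables that answer a challenge to the
  term. Neither sees the environment; this uniformity is what lets a variable be abstracted.\<close>

definition witnesses :: "'u type_structure \<Rightarrow> ('e, 'a, 'c) premise \<Rightarrow> ftype \<Rightarrow> ('e \<Rightarrow> 'u) \<Rightarrow>
    ('a \<Rightarrow> 'u list) \<Rightarrow> ('a \<Rightarrow> 'u list \<Rightarrow> 'c set) \<Rightarrow> bool" where
  "witnesses M \<Gamma> \<sigma> H P Q \<longleftrightarrow>
     (\<forall>e \<in> envs \<Gamma>. H e \<in> carr M (star_of \<sigma>)) \<and>
     (\<forall>a \<in> uppers \<Gamma>. P a \<in> tuples M (tau_pos \<sigma>) \<and>
       (\<forall>d \<in> tuples M (tau_neg \<sigma>). finite (Q a d) \<and> Q a d \<subseteq> lowers \<Gamma> \<and>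
         (\<forall>e \<in> envs \<Gamma>. (\<forall>c \<in> Q a d. holds \<Gamma> e a c) \<longrightarrow> interp M \<sigma> (H e) (P a) d)))"

definition bounded_in :: "'u type_structure \<Rightarrow> ('e, 'a, 'c) premise \<Rightarrow> ftype \<Rightarrow> ('e \<Rightarrow> 'u) \<Rightarrow> bool" where
  "bounded_in M \<Gamma> \<sigma> H \<longleftrightarrow> (\<exists>P Q. witnesses M \<Gamma> \<sigma> H P Q)"

lemma witnessesD:
  assumes "witnesses M \<Gamma> \<sigma> H P Q"
  shows "e \<in> envs \<Gamma> \<Longrightarrow> H e \<in> carr M (star_of \<sigma>)"
    and "a \<in> uppers \<Gamma> \<Longrightarrow> P a \<in> tuples M (tau_pos \<sigma>)"
    and "a \<in> uppers \<Gamma> \<Longrightarrow> d \<in> tuples M (tau_neg \<sigma>) \<Longrightarrow> finite (Q a d)"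
    and "a \<in> uppers \<Gamma> \<Longrightarrow> d \<in> tuples M (tau_neg \<sigma>) \<Longrightarrow> Q a d \<subseteq> lowers \<Gamma>"
    and "a \<in> uppers \<Gamma> \<Longrightarrow> d \<in> tuples M (tau_neg \<sigma>) \<Longrightarrow> e \<in> envs \<Gamma> \<Longrightarrow>
      (\<And>c. c \<in> Q a d \<Longrightarrow> holds \<Gamma> e a c) \<Longrightarrow> interp M \<sigma> (H e) (P a) d"
  using assms unfolding witnesses_def by auto

lemma bounded_inI:
  assumes "\<And>e. e \<in> envs \<Gamma> \<Longrightarrow> H e \<in> carr M (star_of \<sigma>)"
    and "\<And>a. a \<in> uppers \<Gamma> \<Longrightarrow> P a \<in> tuples M (tau_pos \<sigma>)"
    and "\<And>a d. a \<in> uppers \<Gamma> \<Longrightarrow> d \<in> tuples M (tau_neg \<sigma>) \<Longrightarrow> finite (Q a d)"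
    and "\<And>a d. a \<in> uppers \<Gamma> \<Longrightarrow> d \<in> tuples M (tau_neg \<sigma>) \<Longrightarrow> Q a d \<subseteq> lowers \<Gamma>"
    and "\<And>a d e. a \<in> uppers \<Gamma> \<Longrightarrow> d \<in> tuples M (tau_neg \<sigma>) \<Longrightarrow> e \<in> envs \<Gamma> \<Longrightarrow>
      (\<And>c. c \<in> Q a d \<Longrightarrow> holds \<Gamma> e a c) \<Longrightarrow> interp M \<sigma> (H e) (P a) d"
  shows "bounded_in M \<Gamma> \<sigma> H"
  unfolding bounded_in_def witnesses_def using assms by (intro exI[of _ P] exI[of _ Q]) auto

lemma bounded_in_typed: "bounded_in M \<Gamma> \<sigma> H \<Longrightarrow> e \<in> envs \<Gamma> \<Longrightarrow> H e \<in> carr M (star_of \<sigma>)"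
  unfolding bounded_in_def by (blast dest: witnessesD(1))

text \<open>The bound of the variable serves as the bound of the term, and each challenge is passed
  on to the variable.\<close>

lemma bounded_in_var: "bounded_in M (add_var M \<Gamma> \<rho>) \<rho> snd"
  by (rule bounded_inI[where P = snd and Q = "\<lambda>_ d. {Inr d}"]) (auto simp: add_var_def)

lemma bounded_in_weaken:
  assumes "bounded_in M \<Gamma> \<sigma> H"
  shows "bounded_in M (add_var M \<Gamma> \<rho>) \<sigma> (\<lambda>e. H (fst e))"
proof -
  obtain P Q where w: "witnesses M \<Gamma> \<sigma> H P Q" using assms by (auto simp: bounded_in_def)
  show ?thesis
  proof (rule bounded_inI[where P = "\<lambda>a. P (fst a)" and Q = "\<lambda>a d. Inl ` Q (fst a) d"])
    fix a d e
    assume "a \<in> uppers (add_var M \<Gamma> \<rho>)" "d \<in> tuples M (tau_neg \<sigma>)" "e \<in> envs (add_var M \<Gamma> \<rho>)"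
      "\<And>c. c \<in> Inl ` Q (fst a) d \<Longrightarrow> holds (add_var M \<Gamma> \<rho>) e a c"
    then show "interp M \<sigma> (H (fst e)) (P (fst a)) d"
      by (intro witnessesD(5)[OF w]) (force simp: add_var_def)+
  qed (use witnessesD(1-4)[OF w] in \<open>force simp: add_var_def\<close>)+
qed

section \<open>Representing functions and finite sets in the full structure\<close>

locale full_type_structure =
  fixes D :: "stype set" and M :: "'u type_structure"
  assumes full: "full_structure D M"
begin

lemma funD: "\<rho> \<rightarrow>\<^sub>s \<sigma> \<in> D \<Longrightarrow> \<rho> \<in> D \<and> \<sigma> \<in> D"
  and StarD: "Star \<sigma> \<in> D \<Longrightarrow> \<sigma> \<in> D"
  using full unfolding full_structure_def component_closed_def by blast+

lemma carr_SNat: "carr M SNat = range (nat_el M)" and inj_nat_el: "inj (nat_el M)"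
  and carr_SBool: "carr M SBool = range (bool_el M)"
  and bij_fun: "\<rho> \<rightarrow>\<^sub>s \<sigma> \<in> D \<Longrightarrow> bij_betw (\<lambda>h. restrict (app M h) (carr M \<rho>))
    (carr M (\<rho> \<rightarrow>\<^sub>s \<sigma>)) (carr M \<rho> \<rightarrow>\<^sub>E carr M \<sigma>)"
  and bij_elems: "Star \<sigma> \<in> D \<Longrightarrow>
    bij_betw (elems M) (carr M (Star \<sigma>)) {A. A \<subseteq> carr M \<sigma> \<and> finite A \<and> A \<noteq> {}}"
  using full unfolding full_structure_def by (auto simp: bij_betw_def)

lemma app_typed:
  assumes "\<rho> \<rightarrow>\<^sub>s \<sigma> \<in> D" "h \<in> carr M (\<rho> \<rightarrow>\<^sub>s \<sigma>)" "x \<in> carr M \<rho>"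
  shows "app M h x \<in> carr M \<sigma>"
  using PiE_mem[OF bij_betw_apply[OF bij_fun[OF assms(1)] assms(2)] assms(3)] assms(3) by simp

text \<open>This is the surjectivity half of fullness; \<open>restrict\<close> adapts
  \<open>F\<close> to the extensional function space.\<close>

lemma ex_app:
  assumes t: "\<rho> \<rightarrow>\<^sub>s \<sigma> \<in> D" and F: "\<And>x. x \<in> carr M \<rho> \<Longrightarrow> F x \<in> carr M \<sigma>"
  shows "\<exists>h \<in> carr M (\<rho> \<rightarrow>\<^sub>s \<sigma>). \<forall>x \<in> carr M \<rho>. app M h x = F x"
proof -
  have "restrict F (carr M \<rho>) \<in> carr M \<rho> \<rightarrow>\<^sub>E carr M \<sigma>" using F by auto
  then obtain h where h: "h \<in> carr M (\<rho> \<rightarrow>\<^sub>s \<sigma>)"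
    and eq: "restrict F (carr M \<rho>) = restrict (app M h) (carr M \<rho>)"
    using bij_fun[OF t] unfolding bij_betw_def by blast
  have "app M h x = F x" if "x \<in> carr M \<rho>" for x
    using fun_cong[OF eq, of x] that by simp
  with h show ?thesis by blast
qed

lemma ex_elems:
  assumes "Star \<sigma> \<in> D" "A \<subseteq> carr M \<sigma>" "finite A" "A \<noteq> {}"
  shows "\<exists>s \<in> carr M (Star \<sigma>). elems M s = A"
proof -
  have "A \<in> elems M ` carr M (Star \<sigma>)"
    using bij_elems[OF assms(1)] assms(2-4) by (simp add: bij_betw_def)
  then show ?thesis by blast
qed

lemma elems_props:
  assumes "Star \<sigma> \<in> D" "s \<in> carr M (Star \<sigma>)"
  shows "elems M s \<subseteq> carr M \<sigma>" "finite (elems M s)"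
  using bij_betw_apply[OF bij_elems[OF assms(1)] assms(2)] by auto

text \<open>Elements of star types denote non-empty sets, so a default element must be at hand when
  there is nothing to collect. Functional types contain constant functions, star types
  singletons.\<close>

lemma carr_nonempty: "t \<in> D \<Longrightarrow> carr M t \<noteq> {}"
proof (induction t)
  case SNat
  then show ?case by (simp add: carr_SNat)
next
  case SBool
  then show ?case by (simp add: carr_SBool)
next
  case (SFun \<rho> \<sigma>)
  then obtain y where "y \<in> carr M \<sigma>" using funD by blast
  then show ?case using ex_app[OF SFun.prems, of "\<lambda>_. y"] by blast
next
  case (Star \<sigma>)
  then obtain y where "y \<in> carr M \<sigma>" using StarD by blast
  then show ?case using ex_elems[OF Star.prems, of "{y}"] by auto
qed

lemma tuples_nonempty: "set ts \<subseteq> D \<Longrightarrow> tuples M ts \<noteq> {}"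
proof (induction ts)
  case (Cons t ts)
  then obtain x xs where "x \<in> carr M t" "xs \<in> tuples M ts" using carr_nonempty[of t] by auto
  then have "x # xs \<in> tuples M (t # ts)" by (simp add: mem_tuples_iff)
  then show ?case by blast
qed simp

lemma funs_in: "funs ts t \<in> D \<Longrightarrow> set ts \<subseteq> D \<and> t \<in> D"
  by (induction ts) (auto dest: funD)

lemma apps_typed:
  "funs ts t \<in> D \<Longrightarrow> h \<in> carr M (funs ts t) \<Longrightarrow> xs \<in> tuples M ts \<Longrightarrow> apps M h xs \<in> carr M t"
proof (induction ts arbitrary: h xs)
  case (Cons s ts)
  then obtain y ys where xs: "xs = y # ys" "y \<in> carr M s" "ys \<in> tuples M ts"
    by (auto simp: mem_tuples_iff list_all2_Cons2)
  then have "app M h y \<in> carr M (funs ts t)" using Cons.prems by (auto intro: app_typed)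
  then show ?case using Cons.IH[of "app M h y" ys] Cons.prems(1) xs by (auto dest: funD)
qed simp

text \<open>Recursion on the argument types: for each first argument the remaining function is
  represented by induction, and \<open>ex_app\<close> represents the map from first arguments to
  these representatives.\<close>

lemma ex_apps:
  "funs ts t \<in> D \<Longrightarrow> (\<And>xs. xs \<in> tuples M ts \<Longrightarrow> F xs \<in> carr M t) \<Longrightarrow>
    \<exists>h \<in> carr M (funs ts t). \<forall>xs \<in> tuples M ts. apps M h xs = F xs"
proof (induction ts arbitrary: F)
  case (Cons s ts)
  have "\<exists>h \<in> carr M (funs ts t). \<forall>xs \<in> tuples M ts. apps M h xs = F (y # xs)"
    if "y \<in> carr M s" for y
    using Cons.prems that by (intro Cons.IH) (auto dest: funD simp: mem_tuples_iff)
  then obtain G where G: "\<And>y. y \<in> carr M s \<Longrightarrow> G y \<in> carr M (funs ts t) \<and>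
      (\<forall>xs \<in> tuples M ts. apps M (G y) xs = F (y # xs))"
    by metis
  then obtain h where "h \<in> carr M (s \<rightarrow>\<^sub>s funs ts t)" "\<forall>y \<in> carr M s. app M h y = G y"
    using ex_app[of s "funs ts t" G] Cons.prems by auto
  with G show ?case
    by (intro bexI[of _ h]) (auto simp: mem_tuples_iff list_all2_Cons2)
qed simp

lemma ex_map_apps:
  assumes t: "\<And>u. u \<in> set us \<Longrightarrow> funs ts u \<in> D"
    and F: "\<And>xs. xs \<in> tuples M ts \<Longrightarrow> F xs \<in> tuples M us"
  shows "\<exists>fs \<in> tuples M (map (funs ts) us). \<forall>xs \<in> tuples M ts. map (\<lambda>f. apps M f xs) fs = F xs"
proof -
  have "\<exists>h \<in> carr M (funs ts (us ! i)). \<forall>xs \<in> tuples M ts. apps M h xs = F xs ! i"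
    if "i < length us" for i
    using that F by (intro ex_apps t) (auto simp: mem_tuples_iff list_all2_conv_all_nth)
  then obtain h where h: "\<And>i. i < length us \<Longrightarrow> h i \<in> carr M (funs ts (us ! i)) \<and>
      (\<forall>xs \<in> tuples M ts. apps M (h i) xs = F xs ! i)"
    by metis
  show ?thesis
  proof (intro bexI[of _ "map h [0..<length us]"] ballI)
    fix xs assume "xs \<in> tuples M ts"
    then show "map (\<lambda>f. apps M f xs) (map h [0..<length us]) = F xs"
      using h length_tuples[OF F] by (intro nth_equalityI) auto
  qed (use h in \<open>auto simp: mem_tuples_iff list_all2_conv_all_nth\<close>)
qed

lemma map_apps_typed:
  assumes "\<And>u. u \<in> set us \<Longrightarrow> funs ts u \<in> D" "fs \<in> tuples M (map (funs ts) us)" "xs \<in> tuples M ts"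
  shows "map (\<lambda>f. apps M f xs) fs \<in> tuples M us"
  using assms by (auto simp: mem_tuples_iff list_all2_conv_all_nth intro!: apps_typed)

text \<open>
  A finite set of tuples need not be a product of sets, but it is contained in the product of its
  projections; enlarging a set of challenges only weakens the interpretation.
\<close>

lemma ex_star_tuple:
  assumes t: "\<And>u. u \<in> set us \<Longrightarrow> Star u \<in> D" and A: "finite A" "A \<subseteq> tuples M us"
  shows "\<exists>ss \<in> tuples M (map Star us). A \<subseteq> listset (map (elems M) ss)"
proof -
  have "tuples M us \<noteq> {}" using t StarD by (intro tuples_nonempty) auto
  then obtain z where z: "z \<in> tuples M us" by blast
  \<comment> \<open>\<open>z\<close> keeps the projections non-empty when \<open>A\<close> is
    empty.\<close>
  let ?A = "insert z A"
  have A': "finite ?A" "?A \<subseteq> tuples M us" using A z by auto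
  have "\<exists>s \<in> carr M (Star (us ! i)). elems M s = (\<lambda>b. b ! i) ` ?A" if "i < length us" for i
    using that t A' by (intro ex_elems) (auto simp: mem_tuples_iff list_all2_conv_all_nth)
  then obtain s where s: "\<And>i. i < length us \<Longrightarrow>
      s i \<in> carr M (Star (us ! i)) \<and> elems M (s i) = (\<lambda>b. b ! i) ` ?A"
    by metis
  show ?thesis
  proof (intro bexI[of _ "map s [0..<length us]"] subsetI)
    fix b assume b: "b \<in> A"
    then have "length b = length us" using A length_tuples by blast
    then show "b \<in> listset (map (elems M) (map s [0..<length us]))"
      using b s by (auto simp: mem_listset_iff list_all2_conv_all_nth)
  qed (use s in \<open>auto simp: mem_tuples_iff list_all2_conv_all_nth\<close>)
qed

lemma listset_elems:
  assumes "\<And>u. u \<in> set us \<Longrightarrow> Star u \<in> D" "ss \<in> tuples M (map Star us)"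
  shows "finite (listset (map (elems M) ss))" "listset (map (elems M) ss) \<subseteq> tuples M us"
proof -
  have "elems M (ss ! i) \<subseteq> carr M (us ! i) \<and> finite (elems M (ss ! i))" if "i < length us" for i
    using elems_props[of "us ! i" "ss ! i"] assms that by (auto simp: mem_tuples_iff list_all2_conv_all_nth)
  with length_tuples[OF assms(2)]
  show "finite (listset (map (elems M) ss))" "listset (map (elems M) ss) \<subseteq> tuples M us"
    by (auto simp: mem_tuples_iff mem_listset_iff list_all2_conv_all_nth in_set_conv_nth
        intro!: finite_listset) blast
qed

section \<open>Bounds of functional type\<close>

text \<open>These are the typing conditions for handling bounds of functional type; the last two
  pass to the component types.\<close>

lemma types_within_FFun:
  assumes "\<rho> \<rightarrow>\<^sub>f \<sigma> \<in> types_within D"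
  shows "star_of \<rho> \<rightarrow>\<^sub>s star_of \<sigma> \<in> D"
    and "t \<in> set (tau_pos \<sigma>) \<Longrightarrow> funs (tau_pos \<rho>) t \<in> D"
    and "t \<in> set (tau_neg \<rho>) \<Longrightarrow> funs (tau_pos \<rho> @ tau_neg \<sigma>) (Star t) \<in> D"
    and "t \<in> set (tau_neg \<rho>) \<Longrightarrow> Star t \<in> D"
    and "\<rho> \<in> types_within D" "\<sigma> \<in> types_within D"
proof -
  show 1: "star_of \<rho> \<rightarrow>\<^sub>s star_of \<sigma> \<in> D"
    and 2: "\<And>t. t \<in> set (tau_pos \<sigma>) \<Longrightarrow> funs (tau_pos \<rho>) t \<in> D"
    and 3: "\<And>t. t \<in> set (tau_neg \<rho>) \<Longrightarrow> funs (tau_pos \<rho> @ tau_neg \<sigma>) (Star t) \<in> D"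
    using assms by (auto simp: types_within_def)
  show 4: "\<And>t. t \<in> set (tau_neg \<rho>) \<Longrightarrow> Star t \<in> D"
    using 3 funs_in by blast
  \<comment> \<open>\<open>tau_pos \<rho>\<close> and \<open>tau_neg \<sigma>\<close> make up the
    lower tuple at the functional type, while \<open>tau_pos \<sigma>\<close> and, under a star,
    \<open>tau_neg \<rho>\<close> supply the result types in the upper one.\<close>
  show "\<rho> \<in> types_within D" "\<sigma> \<in> types_within D"
    using assms funD[OF 1] funs_in[OF 2] StarD[OF 4] by (auto simp: types_within_def)
qed

lemma upper_typed:
  assumes "\<rho> \<rightarrow>\<^sub>f \<sigma> \<in> types_within D" "p \<in> tuples M (tau_pos (\<rho> \<rightarrow>\<^sub>f \<sigma>))" "a \<in> tuples M (tau_pos \<rho>)"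
  shows "upper M \<sigma> p a \<in> tuples M (tau_pos \<sigma>)"
  unfolding upper_def
  using assms(2,3) types_within_FFun(2)[OF assms(1)]
    take_drop_tuples(1)[of p M "map (funs (tau_pos \<rho>)) (tau_pos \<sigma>)"]
  by (intro map_apps_typed[where ts = "tau_pos \<rho>"]) auto

lemma challenges_props:
  assumes t: "\<rho> \<rightarrow>\<^sub>f \<sigma> \<in> types_within D" and p: "p \<in> tuples M (tau_pos (\<rho> \<rightarrow>\<^sub>f \<sigma>))"
    and "a \<in> tuples M (tau_pos \<rho>)" "d \<in> tuples M (tau_neg \<sigma>)"
  shows "finite (challenges M \<sigma> p a d)" "challenges M \<sigma> p a d \<subseteq> tuples M (tau_neg \<rho>)"
proof -
  let ?g = "drop (length (tau_pos \<sigma>)) p"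
  have "?g \<in> tuples M (map (funs (tau_pos \<rho> @ tau_neg \<sigma>)) (map Star (tau_neg \<rho>)))"
    using p take_drop_tuples(2)[of p M "map (funs (tau_pos \<rho>)) (tau_pos \<sigma>)"] by (simp add: comp_def)
  then have "map (\<lambda>g. apps M g (a @ d)) ?g \<in> tuples M (map Star (tau_neg \<rho>))"
    using types_within_FFun(3)[OF t] append_tuples[OF assms(3,4)] by (intro map_apps_typed) auto
  from listset_elems[OF types_within_FFun(4)[OF t] this]
  show "finite (challenges M \<sigma> p a d)" "challenges M \<sigma> p a d \<subseteq> tuples M (tau_neg \<rho>)"
    by (simp_all add: challenges_def comp_def)
qed

text \<open>Bounds are assembled here from metalevel functions. \<open>F\<close> is represented
  exactly, but \<open>G a d\<close> is only covered, because a tuple of finite sets denotes their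
  product; hence an equation for \<open>upper\<close> and an inclusion for
  \<open>challenges\<close>.\<close>

lemma ex_bound_FFun:
  assumes t: "\<rho> \<rightarrow>\<^sub>f \<sigma> \<in> types_within D"
    and F: "\<And>a. a \<in> tuples M (tau_pos \<rho>) \<Longrightarrow> F a \<in> tuples M (tau_pos \<sigma>)"
    and G: "\<And>a d. a \<in> tuples M (tau_pos \<rho>) \<Longrightarrow> d \<in> tuples M (tau_neg \<sigma>) \<Longrightarrow>
      finite (G a d) \<and> G a d \<subseteq> tuples M (tau_neg \<rho>)"
  shows "\<exists>p \<in> tuples M (tau_pos (\<rho> \<rightarrow>\<^sub>f \<sigma>)). \<forall>a \<in> tuples M (tau_pos \<rho>). upper M \<sigma> p a = F a \<and>
      (\<forall>d \<in> tuples M (tau_neg \<sigma>). G a d \<subseteq> challenges M \<sigma> p a d)"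
proof -
  let ?n = "length (tau_pos \<rho>)"
  obtain f where f: "f \<in> tuples M (map (funs (tau_pos \<rho>)) (tau_pos \<sigma>))"
    "\<And>a. a \<in> tuples M (tau_pos \<rho>) \<Longrightarrow> map (\<lambda>f. apps M f a) f = F a"
    using ex_map_apps[of "tau_pos \<sigma>" "tau_pos \<rho>" F] types_within_FFun(2)[OF t] F by blast
  \<comment> \<open>The functions in \<open>g\<close> take \<open>a\<close> and \<open>d\<close> as
    a single argument tuple, so \<open>G\<close> is covered at each concatenation \<open>c\<close>,
    and the resulting choice \<open>S\<close> is then represented.\<close>
  have "\<exists>ss. ss \<in> tuples M (map Star (tau_neg \<rho>)) \<and>
      G (take ?n c) (drop ?n c) \<subseteq> listset (map (elems M) ss)"
    if "c \<in> tuples M (tau_pos \<rho> @ tau_neg \<sigma>)" for c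
    using ex_star_tuple[where us = "tau_neg \<rho>" and A = "G (take ?n c) (drop ?n c)"]
      types_within_FFun(4)[OF t] G take_drop_tuples[OF that] by blast
  then obtain S where S: "\<And>c. c \<in> tuples M (tau_pos \<rho> @ tau_neg \<sigma>) \<Longrightarrow>
      S c \<in> tuples M (map Star (tau_neg \<rho>)) \<and>
      G (take ?n c) (drop ?n c) \<subseteq> listset (map (elems M) (S c))"
    by metis
  moreover have "funs (tau_pos \<rho> @ tau_neg \<sigma>) u \<in> D" if "u \<in> set (map Star (tau_neg \<rho>))" for u
    using that types_within_FFun(3)[OF t] by auto
  ultimately obtain g where g: "g \<in> tuples M (map (funs (tau_pos \<rho> @ tau_neg \<sigma>)) (map Star (tau_neg \<rho>)))"
    "\<And>c. c \<in> tuples M (tau_pos \<rho> @ tau_neg \<sigma>) \<Longrightarrow> map (\<lambda>g. apps M g c) g = S c"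
    using ex_map_apps[of "map Star (tau_neg \<rho>)" "tau_pos \<rho> @ tau_neg \<sigma>" S] by blast
  have len: "length f = length (tau_pos \<sigma>)" using length_tuples[OF f(1)] by simp
  show ?thesis
  proof (intro bexI[of _ "f @ g"] ballI conjI)
    fix a assume a: "a \<in> tuples M (tau_pos \<rho>)"
    then show "upper M \<sigma> (f @ g) a = F a" using f(2) len by (simp add: upper_def)
    fix d assume d: "d \<in> tuples M (tau_neg \<sigma>)"
    have "challenges M \<sigma> (f @ g) a d = listset (map (elems M) (map (\<lambda>g. apps M g (a @ d)) g))"
      using len by (simp add: challenges_def comp_def)
    also have "\<dots> = listset (map (elems M) (S (a @ d)))"
      using g(2) append_tuples[OF a d] by simp
    finally show "G a d \<subseteq> challenges M \<sigma> (f @ g) a d"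
      using S[OF append_tuples[OF a d]] length_tuples[OF a] by simp
  next
    show "f @ g \<in> tuples M (tau_pos (\<rho> \<rightarrow>\<^sub>f \<sigma>))"
      using append_tuples[OF f(1) g(1)] by (simp add: comp_def)
  qed
qed

lemma tau_neg_FFunE:
  assumes "b \<in> tuples M (tau_neg (\<rho> \<rightarrow>\<^sub>f \<sigma>))"
  obtains a d where "b = a @ d" "a \<in> tuples M (tau_pos \<rho>)" "d \<in> tuples M (tau_neg \<sigma>)"
  using take_drop_tuples[of b M "tau_pos \<rho>" "tau_neg \<sigma>"] assms
    append_take_drop_id[of "length (tau_pos \<rho>)" b] by (metis tau_neg.simps(3))

section \<open>Joins of bounds\<close>

text \<open>By induction on the type. Numbers are joined by their maximum; at functional type the
  values are joined pointwise and the challenges united, which strengthens the premise on the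
  argument and so serves both bounds.\<close>

lemma ex_join:
  "\<sigma> \<in> types_within D \<Longrightarrow> p \<in> tuples M (tau_pos \<sigma>) \<Longrightarrow> q \<in> tuples M (tau_pos \<sigma>) \<Longrightarrow>
    \<exists>r \<in> tuples M (tau_pos \<sigma>). \<forall>x \<in> carr M (star_of \<sigma>). \<forall>b \<in> tuples M (tau_neg \<sigma>).
      interp M \<sigma> x p b \<or> interp M \<sigma> x q b \<longrightarrow> interp M \<sigma> x r b"
proof (induction \<sigma> arbitrary: p q)
  case FNat
  then obtain i j where "p = [nat_el M i]" "q = [nat_el M j]"
    by (auto simp: mem_tuples_iff list_all2_Cons2 carr_SNat)
  then show ?case
    using inj_nat_el
    by (intro bexI[of _ "[nat_el M (max i j)]"])
      (auto simp: mem_tuples_iff carr_SNat inj_eq intro: le_max_iff_disj[THEN iffD2])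
next
  case FBool
  then show ?case by simp
next
  case (FFun \<rho> \<sigma>)
  note t = FFun.prems(1) and p = FFun.prems(2) and q = FFun.prems(3)
  obtain j where j: "\<And>p q. p \<in> tuples M (tau_pos \<sigma>) \<Longrightarrow> q \<in> tuples M (tau_pos \<sigma>) \<Longrightarrow>
      j p q \<in> tuples M (tau_pos \<sigma>)"
    "\<And>p q x b. p \<in> tuples M (tau_pos \<sigma>) \<Longrightarrow> q \<in> tuples M (tau_pos \<sigma>) \<Longrightarrow>
      x \<in> carr M (star_of \<sigma>) \<Longrightarrow> b \<in> tuples M (tau_neg \<sigma>) \<Longrightarrow>
      interp M \<sigma> x p b \<or> interp M \<sigma> x q b \<Longrightarrow> interp M \<sigma> x (j p q) b"
    using FFun.IH(2)[OF types_within_FFun(6)[OF t]] by metis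
  obtain r where r: "r \<in> tuples M (tau_pos (\<rho> \<rightarrow>\<^sub>f \<sigma>))"
    "\<And>a. a \<in> tuples M (tau_pos \<rho>) \<Longrightarrow> upper M \<sigma> r a = j (upper M \<sigma> p a) (upper M \<sigma> q a)"
    "\<And>a d. a \<in> tuples M (tau_pos \<rho>) \<Longrightarrow> d \<in> tuples M (tau_neg \<sigma>) \<Longrightarrow>
      challenges M \<sigma> p a d \<union> challenges M \<sigma> q a d \<subseteq> challenges M \<sigma> r a d"
    using ex_bound_FFun[OF t, of "\<lambda>a. j (upper M \<sigma> p a) (upper M \<sigma> q a)"
        "\<lambda>a d. challenges M \<sigma> p a d \<union> challenges M \<sigma> q a d"]
      j(1) upper_typed[OF t] challenges_props[OF t] p q by (metis Un_least finite_UnI)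
  show ?case
  proof (intro bexI[OF _ r(1)] ballI impI)
    fix h b
    assume h: "h \<in> carr M (star_of (\<rho> \<rightarrow>\<^sub>f \<sigma>))" and "b \<in> tuples M (tau_neg (\<rho> \<rightarrow>\<^sub>f \<sigma>))"
      and *: "interp M (\<rho> \<rightarrow>\<^sub>f \<sigma>) h p b \<or> interp M (\<rho> \<rightarrow>\<^sub>f \<sigma>) h q b"
    then obtain a d where b: "b = a @ d"
      and a: "a \<in> tuples M (tau_pos \<rho>)" and d: "d \<in> tuples M (tau_neg \<sigma>)"
      by (blast elim: tau_neg_FFunE)
    show "interp M (\<rho> \<rightarrow>\<^sub>f \<sigma>) h r b"
      unfolding b interp_FFun_iff[OF a]
    proof (intro ballI impI)
      fix x assume x: "x \<in> carr M (star_of \<rho>)"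
        and "\<forall>b \<in> challenges M \<sigma> r a d. interp M \<rho> x a b"
      \<comment> \<open>The challenges of \<open>r\<close> include those of \<open>p\<close> and of
        \<open>q\<close>, so \<open>x\<close> meets the premise of whichever tuple bounds
        \<open>h\<close>.\<close>
      then have "interp M \<sigma> (app M h x) (upper M \<sigma> p a) d \<or> interp M \<sigma> (app M h x) (upper M \<sigma> q a) d"
        using * r(3)[OF a d] unfolding b interp_FFun_iff[OF a] by blast
      moreover have "app M h x \<in> carr M (star_of \<sigma>)"
        using app_typed types_within_FFun(1)[OF t] h x by simp
      ultimately show "interp M \<sigma> (app M h x) (upper M \<sigma> r a) d"
        unfolding r(2)[OF a] using p q a d t by (intro j(2) upper_typed) auto
    qed
  qed
qed

text \<open>Iterates \<open>ex_join\<close> from \<open>p 0\<close>. A number bounded by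
  \<open>m\<close> has one of the values \<open>0, ..., m\<close>, and a single bound has to serve
  all these cases.\<close>

lemma ex_join_upto:
  fixes p :: "nat \<Rightarrow> 'u list"
  assumes t: "\<sigma> \<in> types_within D" and p: "\<And>n. p n \<in> tuples M (tau_pos \<sigma>)"
  shows "\<exists>r \<in> tuples M (tau_pos \<sigma>). \<forall>n \<le> m. \<forall>x \<in> carr M (star_of \<sigma>). \<forall>b \<in> tuples M (tau_neg \<sigma>).
      interp M \<sigma> x (p n) b \<longrightarrow> interp M \<sigma> x r b"
proof (induction m)
  case 0
  then show ?case using p by auto
next
  case (Suc m)
  then obtain r where r: "r \<in> tuples M (tau_pos \<sigma>)"
    "\<forall>n \<le> m. \<forall>x \<in> carr M (star_of \<sigma>). \<forall>b \<in> tuples M (tau_neg \<sigma>).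
      interp M \<sigma> x (p n) b \<longrightarrow> interp M \<sigma> x r b" by blast
  from ex_join[OF t this(1) p[of "Suc m"]] obtain q where
    "q \<in> tuples M (tau_pos \<sigma>)" "\<forall>x \<in> carr M (star_of \<sigma>). \<forall>b \<in> tuples M (tau_neg \<sigma>).
      interp M \<sigma> x r b \<or> interp M \<sigma> x (p (Suc m)) b \<longrightarrow> interp M \<sigma> x q b" by blast
  with r(2) show ?case by (intro bexI[of _ q]) (auto simp: le_Suc_eq)
qed

section \<open>Abstraction and application\<close>

text \<open>For function types in \<open>D\<close>, injectivity in \<open>bij_fun\<close> leaves at
  most one candidate, so the choice merely names the element.\<close>

definition lam :: "stype \<Rightarrow> stype \<Rightarrow> ('u \<Rightarrow> 'u) \<Rightarrow> 'u" where
  "lam \<rho> \<sigma> F = (SOME h. h \<in> carr M (\<rho> \<rightarrow>\<^sub>s \<sigma>) \<and> (\<forall>x \<in> carr M \<rho>. app M h x = F x))"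

lemma lam_props:
  assumes "\<rho> \<rightarrow>\<^sub>s \<sigma> \<in> D" "\<And>x. x \<in> carr M \<rho> \<Longrightarrow> F x \<in> carr M \<sigma>"
  shows "lam \<rho> \<sigma> F \<in> carr M (\<rho> \<rightarrow>\<^sub>s \<sigma>)" "x \<in> carr M \<rho> \<Longrightarrow> app M (lam \<rho> \<sigma> F) x = F x"
proof -
  have "\<exists>h. h \<in> carr M (\<rho> \<rightarrow>\<^sub>s \<sigma>) \<and> (\<forall>x \<in> carr M \<rho>. app M h x = F x)"
    using ex_app[OF assms(1), of F] assms(2) by blast
  from someI_ex[OF this]
  show "lam \<rho> \<sigma> F \<in> carr M (\<rho> \<rightarrow>\<^sub>s \<sigma>)" "x \<in> carr M \<rho> \<Longrightarrow> app M (lam \<rho> \<sigma> F) x = F x"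
    by (auto simp: lam_def)
qed

text \<open>The challenges that the body raises are divided by their tag: those to the abstracted
  variable go into the bound of the abstraction, those to the other variables remain as its
  answers.\<close>

lemma bounded_in_lam:
  assumes t: "\<rho> \<rightarrow>\<^sub>f \<sigma> \<in> types_within D"
    and "bounded_in M (add_var M \<Gamma> \<rho>) \<sigma> (\<lambda>e. H (fst e) (snd e))"
  shows "bounded_in M \<Gamma> (\<rho> \<rightarrow>\<^sub>f \<sigma>) (\<lambda>e. lam (star_of \<rho>) (star_of \<sigma>) (H e))"
proof -
  obtain P Q where w: "witnesses M (add_var M \<Gamma> \<rho>) \<sigma> (\<lambda>e. H (fst e) (snd e)) P Q"
    using assms(2) by (auto simp: bounded_in_def)
  have H: "H e x \<in> carr M (star_of \<sigma>)" if "e \<in> envs \<Gamma>" "x \<in> carr M (star_of \<rho>)" for e x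
    using witnessesD(1)[OF w, of "(e, x)"] that by (simp add: add_var_def)
  have up: "uppers (add_var M \<Gamma> \<rho>) = uppers \<Gamma> \<times> tuples M (tau_pos \<rho>)"
    by (simp add: add_var_def)
  have Q: "finite (Q (a, p) d)" "Q (a, p) d \<subseteq> lowers \<Gamma> <+> tuples M (tau_neg \<rho>)"
    if "a \<in> uppers \<Gamma>" "p \<in> tuples M (tau_pos \<rho>)" "d \<in> tuples M (tau_neg \<sigma>)" for a p d
    using witnessesD(3,4)[OF w, of "(a, p)"] that by (auto simp: add_var_def)
  \<comment> \<open>The bound \<open>q\<close>, later \<open>R a\<close>, returns the bound of the
    body and covers the challenges tagged \<open>Inr\<close>.\<close>
  have "\<exists>q. q \<in> tuples M (tau_pos (\<rho> \<rightarrow>\<^sub>f \<sigma>)) \<and> (\<forall>p \<in> tuples M (tau_pos \<rho>). upper M \<sigma> q p = P (a, p) \<and>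
      (\<forall>d \<in> tuples M (tau_neg \<sigma>). Inr -` Q (a, p) d \<subseteq> challenges M \<sigma> q p d))"
    if a: "a \<in> uppers \<Gamma>" for a
    unfolding Bex_def[symmetric]
  proof (rule ex_bound_FFun[OF t])
    fix p assume p: "p \<in> tuples M (tau_pos \<rho>)"
    then show "P (a, p) \<in> tuples M (tau_pos \<sigma>)"
      using witnessesD(2)[OF w, of "(a, p)"] a by (simp add: up)
    fix d assume "d \<in> tuples M (tau_neg \<sigma>)"
    then show "finite (Inr -` Q (a, p) d) \<and> Inr -` Q (a, p) d \<subseteq> tuples M (tau_neg \<rho>)"
      using Q[OF a p] by (force intro: finite_vimageI)
  qed
  then obtain R where R: "\<And>a. a \<in> uppers \<Gamma> \<Longrightarrow> R a \<in> tuples M (tau_pos (\<rho> \<rightarrow>\<^sub>f \<sigma>))"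
    "\<And>a p. a \<in> uppers \<Gamma> \<Longrightarrow> p \<in> tuples M (tau_pos \<rho>) \<Longrightarrow> upper M \<sigma> (R a) p = P (a, p)"
    "\<And>a p d. a \<in> uppers \<Gamma> \<Longrightarrow> p \<in> tuples M (tau_pos \<rho>) \<Longrightarrow> d \<in> tuples M (tau_neg \<sigma>) \<Longrightarrow>
      Inr -` Q (a, p) d \<subseteq> challenges M \<sigma> (R a) p d"
    by metis
  let ?n = "length (tau_pos \<rho>)"
  \<comment> \<open>A challenge at functional type is a bound of the argument followed by a
    challenge to the value; the body is queried with both.\<close>
  let ?Q = "\<lambda>a n. Inl -` Q (a, take ?n n) (drop ?n n)"
  show ?thesis
  proof (rule bounded_inI[where P = R and Q = ?Q])
    fix e assume "e \<in> envs \<Gamma>"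
    then show "lam (star_of \<rho>) (star_of \<sigma>) (H e) \<in> carr M (star_of (\<rho> \<rightarrow>\<^sub>f \<sigma>))"
      using lam_props(1)[OF types_within_FFun(1)[OF t], of "H e"] H by simp
  next
    fix a n assume a: "a \<in> uppers \<Gamma>" and "n \<in> tuples M (tau_neg (\<rho> \<rightarrow>\<^sub>f \<sigma>))"
    then obtain p d where n: "n = p @ d" "p \<in> tuples M (tau_pos \<rho>)" "d \<in> tuples M (tau_neg \<sigma>)"
      by (blast elim: tau_neg_FFunE)
    have Qeq: "?Q a n = Inl -` Q (a, p) d"
      using length_tuples[OF n(2)] by (simp add: n(1))
    show "finite (?Q a n)" "?Q a n \<subseteq> lowers \<Gamma>"
      unfolding Qeq using Q[OF a n(2,3)] by (force intro: finite_vimageI)+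
    fix e assume e: "e \<in> envs \<Gamma>" and sat: "\<And>c. c \<in> ?Q a n \<Longrightarrow> holds \<Gamma> e a c"
    show "interp M (\<rho> \<rightarrow>\<^sub>f \<sigma>) (lam (star_of \<rho>) (star_of \<sigma>) (H e)) (R a) n"
      unfolding n(1) interp_FFun_iff[OF n(2)] R(2)[OF a n(2)]
    proof (intro ballI impI)
      fix x assume x: "x \<in> carr M (star_of \<rho>)"
        and ch: "\<forall>b \<in> challenges M \<sigma> (R a) p d. interp M \<rho> x p b"
      \<comment> \<open>Challenges tagged \<open>Inl\<close> are met by \<open>sat\<close>, those
        tagged \<open>Inr\<close> by \<open>ch\<close>, because \<open>R a\<close> covers
        them.\<close>
      have "holds (add_var M \<Gamma> \<rho>) (e, x) (a, p) c" if "c \<in> Q (a, p) d" for c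
        using that ch R(3)[OF a n(2,3)] sat unfolding Qeq
        by (cases c) (auto simp: add_var_def)
      then have "interp M \<sigma> (H e x) (P (a, p)) d"
        using witnessesD(5)[OF w, of "(a, p)" d "(e, x)"] a e x n(2,3) by (simp add: add_var_def)
      then show "interp M \<sigma> (app M (lam (star_of \<rho>) (star_of \<sigma>) (H e)) x) (P (a, p)) d"
        using lam_props(2)[OF types_within_FFun(1)[OF t], of "H e" x] H[OF e] x by simp
    qed
  qed (rule R(1))
qed

text \<open>A challenge \<open>d\<close> to the value becomes \<open>P' a @ d\<close> for the
  function, whose bound then names finitely many challenges to the argument. Each of these is
  answered in turn, and the union stays finite.\<close>

lemma bounded_in_app:
  assumes t: "\<rho> \<rightarrow>\<^sub>f \<sigma> \<in> types_within D"
    and "bounded_in M \<Gamma> (\<rho> \<rightarrow>\<^sub>f \<sigma>) H" "bounded_in M \<Gamma> \<rho> X"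
  shows "bounded_in M \<Gamma> \<sigma> (\<lambda>e. app M (H e) (X e))"
proof -
  obtain P Q where H: "witnesses M \<Gamma> (\<rho> \<rightarrow>\<^sub>f \<sigma>) H P Q" using assms(2) by (auto simp: bounded_in_def)
  obtain P' Q' where X: "witnesses M \<Gamma> \<rho> X P' Q'" using assms(3) by (auto simp: bounded_in_def)
  let ?C = "\<lambda>a d. challenges M \<sigma> (P a) (P' a) d"
  let ?Q = "\<lambda>a d. Q a (P' a @ d) \<union> (\<Union>b \<in> ?C a d. Q' a b)"
  show ?thesis
  proof (rule bounded_inI[where P = "\<lambda>a. upper M \<sigma> (P a) (P' a)" and Q = ?Q])
    fix e assume "e \<in> envs \<Gamma>"
    then show "app M (H e) (X e) \<in> carr M (star_of \<sigma>)"
      using app_typed[OF types_within_FFun(1)[OF t]] witnessesD(1)[OF H] witnessesD(1)[OF X] by simp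
  next
    fix a assume a: "a \<in> uppers \<Gamma>"
    note P = witnessesD(2)[OF H a] and P' = witnessesD(2)[OF X a]
    show "upper M \<sigma> (P a) (P' a) \<in> tuples M (tau_pos \<sigma>)" by (rule upper_typed[OF t P P'])
    fix d assume d: "d \<in> tuples M (tau_neg \<sigma>)"
    have d': "P' a @ d \<in> tuples M (tau_neg (\<rho> \<rightarrow>\<^sub>f \<sigma>))" using append_tuples[OF P' d] by simp
    note C = challenges_props[OF t P P' d]
    show "finite (?Q a d)" "?Q a d \<subseteq> lowers \<Gamma>"
      using C witnessesD(3,4)[OF H a d'] witnessesD(3,4)[OF X a] by blast+
    fix e assume e: "e \<in> envs \<Gamma>" and sat: "\<And>c. c \<in> ?Q a d \<Longrightarrow> holds \<Gamma> e a c"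
    have "interp M (\<rho> \<rightarrow>\<^sub>f \<sigma>) (H e) (P a) (P' a @ d)"
      by (rule witnessesD(5)[OF H a d' e]) (rule sat, blast)
    moreover have "interp M \<rho> (X e) (P' a) b" if "b \<in> ?C a d" for b
      using that C(2) by (intro witnessesD(5)[OF X a _ e] sat) blast+
    ultimately show "interp M \<sigma> (app M (H e) (X e)) (upper M \<sigma> (P a) (P' a)) d"
      using witnessesD(1)[OF X e] unfolding interp_FFun_iff[OF P'] by blast
  qed
qed

section \<open>Numbers and definition by cases\<close>

lemma bounded_in_nat: "bounded_in M \<Gamma> FNat (\<lambda>_. nat_el M n)"
  by (rule bounded_inI[where P = "\<lambda>_. [nat_el M n]" and Q = "\<lambda>_ _. {}"])
    (auto simp: carr_SNat mem_tuples_iff)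

definition nat_of :: "'u \<Rightarrow> nat" where "nat_of = inv (nat_el M)"

lemma nat_of_nat_el [simp]: "nat_of (nat_el M n) = n"
  by (simp add: nat_of_def inj_nat_el)

text \<open>
  The only step that is not pure lambda calculus: an upper bound \<open>m\<close> of a number leaves finitely many
  cases, whose witnesses are joined and whose challenges are united.
\<close>

lemma bounded_in_cases:
  assumes t: "\<sigma> \<in> types_within D"
    and "bounded_in M \<Gamma> FNat X" "\<And>n. bounded_in M \<Gamma> \<sigma> (H n)"
  shows "bounded_in M \<Gamma> \<sigma> (\<lambda>e. H (nat_of (X e)) e)"
proof -
  obtain P Q where X: "witnesses M \<Gamma> FNat X P Q" using assms(2) by (auto simp: bounded_in_def)
  obtain P' Q' where H: "\<And>n. witnesses M \<Gamma> \<sigma> (H n) (P' n) (Q' n)"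
    using assms(3) unfolding bounded_in_def by metis
  \<comment> \<open>A bound of type \<open>FNat\<close> is a one-element tuple, and its entry codes
    the largest value allowed.\<close>
  let ?m = "\<lambda>a. nat_of (hd (P a))"
  have "\<exists>r. r \<in> tuples M (tau_pos \<sigma>) \<and>
      (\<forall>n \<le> ?m a. \<forall>x \<in> carr M (star_of \<sigma>). \<forall>b \<in> tuples M (tau_neg \<sigma>).
        interp M \<sigma> x (P' n a) b \<longrightarrow> interp M \<sigma> x r b)" if "a \<in> uppers \<Gamma>" for a
    using ex_join_upto[OF t, of "\<lambda>n. P' n a" "?m a"] witnessesD(2)[OF H that] by blast
  then obtain R where R: "\<And>a. a \<in> uppers \<Gamma> \<Longrightarrow> R a \<in> tuples M (tau_pos \<sigma>)"
    "\<And>a n x b. a \<in> uppers \<Gamma> \<Longrightarrow> n \<le> ?m a \<Longrightarrow> x \<in> carr M (star_of \<sigma>) \<Longrightarrow>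
        b \<in> tuples M (tau_neg \<sigma>) \<Longrightarrow> interp M \<sigma> x (P' n a) b \<Longrightarrow> interp M \<sigma> x (R a) b"
    by metis
  \<comment> \<open>The lower tuple at \<open>FNat\<close> is empty, so \<open>[]\<close> is the
    only challenge to \<open>X\<close>; answering it secures \<open>nat_of (X e) \<le> ?m a\<close>,
    and thus that the actual case is among those united.\<close>
  let ?Q = "\<lambda>a d. Q a [] \<union> (\<Union>n \<le> ?m a. Q' n a d)"
  have nil: "[] \<in> tuples M (tau_neg FNat)" by simp
  show ?thesis
  proof (rule bounded_inI[where P = R and Q = ?Q])
    fix e assume "e \<in> envs \<Gamma>"
    then show "H (nat_of (X e)) e \<in> carr M (star_of \<sigma>)" by (rule witnessesD(1)[OF H])
  next
    fix a d assume a: "a \<in> uppers \<Gamma>" and d: "d \<in> tuples M (tau_neg \<sigma>)"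
    show "finite (?Q a d)" "?Q a d \<subseteq> lowers \<Gamma>"
      using witnessesD(3,4)[OF X a nil] witnessesD(3,4)[OF H a d] by blast+
    fix e assume e: "e \<in> envs \<Gamma>" and sat: "\<And>c. c \<in> ?Q a d \<Longrightarrow> holds \<Gamma> e a c"
    have "interp M FNat (X e) (P a) []"
      by (rule witnessesD(5)[OF X a nil e]) (rule sat, blast)
    then have le: "nat_of (X e) \<le> ?m a" by auto
    show "interp M \<sigma> (H (nat_of (X e)) e) (R a) d"
      using le by (intro R(2)[OF a le witnessesD(1)[OF H e] d] witnessesD(5)[OF H a d e] sat) blast
  qed (rule R(1))
qed

section \<open>The constants of T in the bounded structure\<close>

text \<open>Over the trivial context the conditions are vacuous and the bound is constant, which
  leaves exactly the definition of \<open>C_le\<close>.\<close>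

lemma C_le_iff_bounded_in:
  "x \<in> C_le M \<sigma> \<longleftrightarrow> bounded_in M empty_premise \<sigma> (\<lambda>_. x)"
proof
  assume "x \<in> C_le M \<sigma>"
  then obtain a where "x \<in> carr M (star_of \<sigma>)" "a \<in> tuples M (tau_pos \<sigma>)"
    "\<forall>b \<in> tuples M (tau_neg \<sigma>). interp M \<sigma> x a b"
    by (auto simp: C_le_def)
  then show "bounded_in M empty_premise \<sigma> (\<lambda>_. x)"
    by (intro bounded_inI[where P = "\<lambda>_. a" and Q = "\<lambda>_ _. {}"]) auto
next
  assume "bounded_in M empty_premise \<sigma> (\<lambda>_. x)"
  then show "x \<in> C_le M \<sigma>"
    by (auto simp: C_le_def bounded_in_def witnesses_def empty_premise_def)
qed

lemma C_le_FNat: "C_le M FNat = carr M SNat"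
proof
  show "carr M SNat \<subseteq> C_le M FNat"
    using bounded_in_nat by (auto simp: carr_SNat C_le_iff_bounded_in)
qed (auto simp: C_le_def)

lemma C_le_app:
  "\<rho> \<rightarrow>\<^sub>f \<sigma> \<in> types_within D \<Longrightarrow> h \<in> C_le M (\<rho> \<rightarrow>\<^sub>f \<sigma>) \<Longrightarrow> x \<in> C_le M \<rho> \<Longrightarrow> app M h x \<in> C_le M \<sigma>"
  unfolding C_le_iff_bounded_in by (rule bounded_in_app)

text \<open>Environments are nested pairs, so projections act as de Bruijn indices:
  \<open>snd\<close> is the innermost variable, \<open>snd (fst e)\<close> the next one.\<close>

lemma bounded_in_outer_var: "bounded_in M (add_var M (add_var M \<Gamma> \<rho>) \<sigma>) \<rho> (\<lambda>e. snd (fst e))"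
  by (rule bounded_in_weaken[OF bounded_in_var])

lemma ex_combinator_K:
  assumes t: "\<rho> \<rightarrow>\<^sub>f \<sigma> \<rightarrow>\<^sub>f \<rho> \<in> types_within D"
  shows "\<exists>k \<in> C_le M (\<rho> \<rightarrow>\<^sub>f \<sigma> \<rightarrow>\<^sub>f \<rho>). \<forall>x \<in> carr M (star_of \<rho>). \<forall>y \<in> carr M (star_of \<sigma>).
    app M (app M k x) y = x"
proof -
  note t' = types_within_FFun(6)[OF t]
  note D = types_within_FFun(1)[OF t, simplified] types_within_FFun(1)[OF t']
  let ?k = "lam (star_of \<rho>) (star_of (\<sigma> \<rightarrow>\<^sub>f \<rho>)) (\<lambda>x. lam (star_of \<sigma>) (star_of \<rho>) (\<lambda>_. x))"
  have "?k \<in> C_le M (\<rho> \<rightarrow>\<^sub>f \<sigma> \<rightarrow>\<^sub>f \<rho>)"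
    unfolding C_le_iff_bounded_in by (intro bounded_in_lam t t' bounded_in_outer_var)
  then show ?thesis
    using D by (intro bexI[of _ ?k]) (auto simp: lam_props)
qed

lemma ex_combinator_S:
  assumes t: "(\<rho> \<rightarrow>\<^sub>f \<sigma> \<rightarrow>\<^sub>f \<tau>) \<rightarrow>\<^sub>f (\<rho> \<rightarrow>\<^sub>f \<sigma>) \<rightarrow>\<^sub>f \<rho> \<rightarrow>\<^sub>f \<tau> \<in> types_within D"
  shows "\<exists>s \<in> C_le M ((\<rho> \<rightarrow>\<^sub>f \<sigma> \<rightarrow>\<^sub>f \<tau>) \<rightarrow>\<^sub>f (\<rho> \<rightarrow>\<^sub>f \<sigma>) \<rightarrow>\<^sub>f \<rho> \<rightarrow>\<^sub>f \<tau>).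
    \<forall>x \<in> carr M (star_of (\<rho> \<rightarrow>\<^sub>f \<sigma> \<rightarrow>\<^sub>f \<tau>)). \<forall>y \<in> carr M (star_of (\<rho> \<rightarrow>\<^sub>f \<sigma>)). \<forall>z \<in> carr M (star_of \<rho>).
      app M (app M (app M s x) y) z = app M (app M x z) (app M y z)"
proof -
  \<comment> \<open>\<open>t\<close>, \<open>t2\<close>, \<open>t3\<close> type the three
    abstractions; \<open>tx\<close>, \<open>tx2\<close>, \<open>ty\<close> type the applications in
    the body.\<close>
  note tx = types_within_FFun(5)[OF t] and t2 = types_within_FFun(6)[OF t]
  note ty = types_within_FFun(5)[OF t2] and t3 = types_within_FFun(6)[OF t2]
    and tx2 = types_within_FFun(6)[OF tx]
  note D = types_within_FFun(1)[OF tx, simplified] types_within_FFun(1)[OF tx2]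
    types_within_FFun(1)[OF ty] types_within_FFun(1)[OF t, simplified]
    types_within_FFun(1)[OF t2, simplified] types_within_FFun(1)[OF t3]
  let ?s = "lam (star_of (\<rho> \<rightarrow>\<^sub>f \<sigma> \<rightarrow>\<^sub>f \<tau>)) (star_of ((\<rho> \<rightarrow>\<^sub>f \<sigma>) \<rightarrow>\<^sub>f \<rho> \<rightarrow>\<^sub>f \<tau>))
    (\<lambda>x. lam (star_of (\<rho> \<rightarrow>\<^sub>f \<sigma>)) (star_of (\<rho> \<rightarrow>\<^sub>f \<tau>))
      (\<lambda>y. lam (star_of \<rho>) (star_of \<tau>) (\<lambda>z. app M (app M x z) (app M y z))))"
  have "?s \<in> C_le M ((\<rho> \<rightarrow>\<^sub>f \<sigma> \<rightarrow>\<^sub>f \<tau>) \<rightarrow>\<^sub>f (\<rho> \<rightarrow>\<^sub>f \<sigma>) \<rightarrow>\<^sub>f \<rho> \<rightarrow>\<^sub>f \<tau>)"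
    unfolding C_le_iff_bounded_in
    by (intro bounded_in_lam t t2 t3 bounded_in_app[OF tx2] bounded_in_app[OF tx]
        bounded_in_app[OF ty] bounded_in_var bounded_in_weaken[OF bounded_in_outer_var] bounded_in_outer_var)
  then show ?thesis
    using D by (intro bexI[of _ ?s]) (auto simp: lam_props app_typed)
qed

text \<open>A definition by cases whose branches are fixed numbers, each bounded by itself.\<close>

lemma ex_successor:
  assumes t: "FNat \<rightarrow>\<^sub>f FNat \<in> types_within D"
  shows "\<exists>s \<in> C_le M (FNat \<rightarrow>\<^sub>f FNat). \<forall>n. app M s (nat_el M n) = nat_el M (Suc n)"
proof -
  let ?s = "lam (star_of FNat) (star_of FNat) (\<lambda>x. nat_el M (Suc (nat_of x)))"
  have "?s \<in> C_le M (FNat \<rightarrow>\<^sub>f FNat)"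
    unfolding C_le_iff_bounded_in
    by (intro bounded_in_lam t bounded_in_cases[where H = "\<lambda>n _. nat_el M (Suc n)"]
        types_within_FFun(5)[OF t] bounded_in_var bounded_in_nat)
  then show ?thesis
    using types_within_FFun(1)[OF t] by (intro bexI[of _ ?s]) (auto simp: lam_props carr_SNat)
qed

text \<open>Boundedness is shown for each fixed number of iterations and then transferred through
  definition by cases; the recursion itself takes place outside the structure.\<close>

lemma ex_recursor:
  assumes t: "FNat \<rightarrow>\<^sub>f \<sigma> \<rightarrow>\<^sub>f (FNat \<rightarrow>\<^sub>f \<sigma> \<rightarrow>\<^sub>f \<sigma>) \<rightarrow>\<^sub>f \<sigma> \<in> types_within D"
  shows "\<exists>r \<in> C_le M (FNat \<rightarrow>\<^sub>f \<sigma> \<rightarrow>\<^sub>f (FNat \<rightarrow>\<^sub>f \<sigma> \<rightarrow>\<^sub>f \<sigma>) \<rightarrow>\<^sub>f \<sigma>).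
    \<forall>w \<in> carr M (star_of \<sigma>). \<forall>f \<in> carr M (star_of (FNat \<rightarrow>\<^sub>f \<sigma> \<rightarrow>\<^sub>f \<sigma>)).
      apps M r [nat_el M 0, w, f] = w \<and>
      (\<forall>n. apps M r [nat_el M (Suc n), w, f] =
           apps M f [nat_el M n, apps M r [nat_el M n, w, f]])"
proof -
  note t2 = types_within_FFun(6)[OF t]
  note t3 = types_within_FFun(6)[OF t2]
  note tf = types_within_FFun(5)[OF t3]
  note tf2 = types_within_FFun(6)[OF tf]
  note D = types_within_FFun(1)[OF t, simplified] types_within_FFun(1)[OF t2, simplified]
    types_within_FFun(1)[OF t3, simplified] types_within_FFun(1)[OF tf, simplified]
    types_within_FFun(1)[OF tf2]
  define it where "it n w f = rec_nat w (\<lambda>k v. app M (app M f (nat_el M k)) v) n" for n w f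
  \<comment> \<open>The context lists the number, \<open>w\<close> and \<open>f\<close>; thus
    \<open>snd (fst e)\<close> is \<open>w\<close> and \<open>snd e\<close> is
    \<open>f\<close>.\<close>
  let ?\<Gamma> = "add_var M (add_var M (add_var M empty_premise FNat) \<sigma>) (FNat \<rightarrow>\<^sub>f \<sigma> \<rightarrow>\<^sub>f \<sigma>)"
  have it: "bounded_in M ?\<Gamma> \<sigma> (\<lambda>e. it n (snd (fst e)) (snd e))" for n
  proof (induction n)
    case 0
    show ?case by (simp add: it_def bounded_in_outer_var)
  next
    case (Suc n)
    have "bounded_in M ?\<Gamma> \<sigma>
        (\<lambda>e. app M (app M (snd e) (nat_el M n)) (it n (snd (fst e)) (snd e)))"
      by (intro bounded_in_app[OF tf2] bounded_in_app[OF tf] bounded_in_var bounded_in_nat Suc)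
    then show ?case by (simp add: it_def)
  qed
  \<comment> \<open>Typing is part of boundedness; \<open>nat_el M 0\<close> merely fills the place
    of the number in the environment.\<close>
  have it_typed: "it n w f \<in> carr M (star_of \<sigma>)"
    if "w \<in> carr M (star_of \<sigma>)" "f \<in> carr M (star_of (FNat \<rightarrow>\<^sub>f \<sigma> \<rightarrow>\<^sub>f \<sigma>))" for n w f
    using bounded_in_typed[OF it, of "((((), nat_el M 0), w), f)" n] that
    by (simp add: add_var_def empty_premise_def carr_SNat)
  let ?r = "lam (star_of FNat) (star_of (\<sigma> \<rightarrow>\<^sub>f (FNat \<rightarrow>\<^sub>f \<sigma> \<rightarrow>\<^sub>f \<sigma>) \<rightarrow>\<^sub>f \<sigma>))
    (\<lambda>x. lam (star_of \<sigma>) (star_of ((FNat \<rightarrow>\<^sub>f \<sigma> \<rightarrow>\<^sub>f \<sigma>) \<rightarrow>\<^sub>f \<sigma>))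
      (\<lambda>w. lam (star_of (FNat \<rightarrow>\<^sub>f \<sigma> \<rightarrow>\<^sub>f \<sigma>)) (star_of \<sigma>) (\<lambda>f. it (nat_of x) w f)))"
  \<comment> \<open>The case distinction happens under all three binders, on the outermost
    variable.\<close>
  have r: "?r \<in> C_le M (FNat \<rightarrow>\<^sub>f \<sigma> \<rightarrow>\<^sub>f (FNat \<rightarrow>\<^sub>f \<sigma> \<rightarrow>\<^sub>f \<sigma>) \<rightarrow>\<^sub>f \<sigma>)"
    unfolding C_le_iff_bounded_in
    by (intro bounded_in_lam t t2 t3 it types_within_FFun(6)[OF t3] bounded_in_weaken[OF bounded_in_outer_var]
        bounded_in_cases[where H = "\<lambda>n e. it n (snd (fst e)) (snd e)"])
  have eq: "apps M ?r [nat_el M n, w, f] = it n w f"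
    if "w \<in> carr M (star_of \<sigma>)" "f \<in> carr M (star_of (FNat \<rightarrow>\<^sub>f \<sigma> \<rightarrow>\<^sub>f \<sigma>))" for n w f
    using D that it_typed by (simp add: lam_props carr_SNat)
  show ?thesis
  proof (intro bexI[OF _ r] ballI conjI allI)
    fix w f n assume w: "w \<in> carr M (star_of \<sigma>)" and f: "f \<in> carr M (star_of (FNat \<rightarrow>\<^sub>f \<sigma> \<rightarrow>\<^sub>f \<sigma>))"
    show "apps M ?r [nat_el M 0, w, f] = w"
      unfolding eq[OF w f] by (simp add: it_def)
    show "apps M ?r [nat_el M (Suc n), w, f] = apps M f [nat_el M n, apps M ?r [nat_el M n, w, f]]"
      unfolding eq[OF w f] by (simp add: it_def)
  qed
qed

end

theorem theorem8p23:
  fixes M :: "'u type_structure" and D :: "stype set"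
  assumes "full_structure D M"
  shows "model_of_T (types_within D) M (C_le M)"
proof -
  interpret full_type_structure D M by (rule full_type_structure.intro) (rule assms)
  have "nat_el M 0 \<in> C_le M FNat" by (simp add: C_le_FNat carr_SNat)
  moreover have "C_le M \<sigma> \<subseteq> carr M (star_of \<sigma>)" for \<sigma> by (auto simp: C_le_def)
  ultimately show ?thesis
    unfolding model_of_T_def
    by (intro conjI ballI allI impI C_le_FNat)
      (blast intro: C_le_app ex_combinator_K ex_combinator_S ex_successor ex_recursor)+
qed

end
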